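(* Let $B=(B_t)_{t\ge 0}$ be a real-valued standard Brownian motion with $B_0=0$. For $\gamma\in[0,\tfrac12]$ let $$E_\gamma=\{t\ge 0: |B_t|\le t^{\gamma}\}.$$ Almost surely, for all $\gamma\in[0,\tfrac12]$, $$\mathrm{Dim}_\mathrm{H} E_\gamma=\begin{cases}\tfrac12 & \text{if } \gamma\in[0,\tfrac12),\\ 1 & \text{if } \gamma=\tfrac12,\end{cases}$$ and $$\mathrm{Dim}_\mathrm{UM} E_\gamma=\mathrm{Den}_{\log} E_\gamma=\tfrac12+\gamma .$$
   Context: Notation: $|A|$ is Lebesgue measure. Let $\mathcal S_0=[0,1)$ and $\mathcal S_n=[2^{n-1},2^n)$ for $n\ge1$. For $E\subset\mathbb R^+$, $\rho\ge0$ and $n\ge1$, let $$\nu^n_\rho(E)=\inf\Big\{\sum_{i=1}^m\Big(\frac{|Q_i|}{2^n}\Big)^\rho: Q_i\subset\mathcal S_n \text{ non-trivial intervals with integer endpoints},\ E\cap\mathcal S_n\subset\bigcup_{i=1}^m Q_i\Big\},$$ the infimum being over finite families. The macroscopic Hausdorff dimension is $\mathrm{Dim}_\mathrm{H}E=\inf\{\rho\ge0:\sum_{n\ge1}\nu^n_\rho(E)<\infty\}$. For $E\subset\mathbb R^+$, $\mathrm{pix}(E)=\{x\in\mathbb Z:\mathrm{dist}(x,E)\le1\}$; the upper mass dimension is $\mathrm{Dim}_\mathrm{UM}E=\limsup_{n\to\infty}\frac{\log_2\sharp\,\mathrm{pix}(E\cap[0,2^n])}{n}$, and the logarithmic density is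 $\mathrm{Den}_{\log}E=\limsup_{n\to\infty}\frac{\log_2|E\cap[0,2^n]|}{n}$. *)

theory Defs
  imports "HOL-Probability.Probability"
begin

definition brownian_motion :: "'a measure \<Rightarrow> ('a \<Rightarrow> real \<Rightarrow> real) \<Rightarrow> bool" where
  "brownian_motion M B \<longleftrightarrow>
     prob_space M \<and>
     (\<forall>t\<ge>0. (\<lambda>\<omega>. B \<omega> t) \<in> borel_measurable M) \<and>
     (AE \<omega> in M. B \<omega> 0 = 0 \<and> continuous_on {0..} (B \<omega>)) \<and>
     (\<forall>s t. 0 \<le> s \<longrightarrow> s < t \<longrightarrow>
        distributed M lborel (\<lambda>\<omega>. B \<omega> t - B \<omega> s)
          (\<lambda>x. ennreal (normal_density 0 (sqrt (t - s)) x))) \<and>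
     (\<forall>ts :: real list. sorted_wrt (<) ts \<longrightarrow> (\<forall>t\<in>set ts. 0 \<le> t) \<longrightarrow>
        prob_space.indep_vars M (\<lambda>_. borel)
          (\<lambda>i \<omega>. B \<omega> (ts ! Suc i) - B \<omega> (ts ! i)) {..<length ts - 1})"

definition shell :: "nat \<Rightarrow> real set" where
  "shell n = {2 ^ (n - 1) ..< 2 ^ n}"

text \<open>Non-trivial intervals (of any type: open, closed, half-open) with integer endpoints
  contained in S_n.\<close>
definition int_interval_in :: "nat \<Rightarrow> real set \<Rightarrow> bool" where
  "int_interval_in n Q \<longleftrightarrow>
     (\<exists>a b :: int. a < b \<and> {real_of_int a <..< real_of_int b} \<subseteq> Q \<and>
        Q \<subseteq> {real_of_int a .. real_of_int b}) \<and> Q \<subseteq> shell n"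

definition nu :: "nat \<Rightarrow> real \<Rightarrow> real set \<Rightarrow> real" where
  "nu n \<rho> E = Inf {(\<Sum>Q\<in>F. (measure lebesgue Q / 2 ^ n) powr \<rho>) | F.
       finite F \<and> (\<forall>Q\<in>F. int_interval_in n Q) \<and> E \<inter> shell n \<subseteq> \<Union>F}"

definition macro_Hdim :: "real set \<Rightarrow> real" where
  "macro_Hdim E = Inf {\<rho>. \<rho> \<ge> 0 \<and> summable (\<lambda>n. nu (Suc n) \<rho> E)}"

definition pix :: "real set \<Rightarrow> int set" where
  "pix E = {x. E \<noteq> {} \<and> infdist (real_of_int x) E \<le> 1}"

definition upper_mass_dim :: "real set \<Rightarrow> ereal" where
  "upper_mass_dim E =
     limsup (\<lambda>n::nat. ereal (log 2 (real (card (pix (E \<inter> {0 .. 2 ^ n})))) / real n))"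

definition log_density :: "real set \<Rightarrow> ereal" where
  "log_density E =
     limsup (\<lambda>n::nat. ereal (log 2 (measure lebesgue (E \<inter> {0 .. 2 ^ n})) / real n))"

end

theory Submission
  imports Defs
begin

text \<open>
  Let \<open>E\<close> be the set of times in question. The first and second moments below are those of finite
  sums over integer times, so only one- and two-time marginals of the Brownian motion enter.

  Upper bounds: the number of grid intervals of length \<open>2^m\<close> in \<open>[0, 2^n]\<close> which meet \<open>E\<close> is
  controlled by a first moment, after bounding the oscillation on grid intervals by dyadic
  chaining. Taking \<open>m = 0\<close> bounds the upper mass dimension, and \<open>m\<close> close to \<open>2 \<gamma> n\<close> the Hausdorff
  dimension.

  Lower bounds: the sum of \<open>k powr (-1/2 - \<gamma>)\<close> over the integers \<open>k < 2^N\<close> with \<open>2 \<bar>B k\<bar> \<le> k powr \<gamma>\<close>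
  has mean at least of order \<open>N\<close> and variance at most of order \<open>N\<close>, so along a sparse sequence of \<open>N\<close> it is
  almost surely at least of order \<open>N\<close>. This forces \<open>E\<close> to be large in infinitely many shells, which gives
  the density and the case \<open>\<gamma> = 1/2\<close> of the Hausdorff dimension. For \<open>\<gamma> < 1/2\<close> an energy estimate on
  each shell, combined with the Cauchy-Schwarz inequality across the shells, shows that the
  sum of the contents diverges for every exponent below \<open>1/2\<close>; no zero-one law is needed.

  Monotonicity in \<open>\<gamma>\<close> on \<open>[1, \<infinity>)\<close> reduces the statement for all \<open>\<gamma>\<close> to countably many exponents.
\<close>

section \<open>The standard Gaussian measure\<close>

text \<open>For \<open>\<gamma> < 1/2\<close> no lower bound can be expected shell by shell: with a
  probability that does not tend to 0 the path stays away from the region throughout a shell. The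
  lower bounds therefore add up all shells below N. \<open>B k\<close> lies in the region with
  probability of order \<open>k powr (\<gamma> - 1/2)\<close>; the weight
  \<open>k powr (-1/2 - \<gamma>)\<close> turns this into 1/k, so that every shell contributes a
  constant to the mean. Likewise \<open>2 powr (-(1 - \<rho>) * n)\<close> normalises the energy of
  a shell to bounded mean. The sparse sequence is N = i^4. The energy sum then has mean O(i^4) and
  eventually stays below i^6, the surplus i^2 making Markov's bound summable. Cauchy-Schwarz sets
  (i^4)^2 = i^8 against i^6 times the sum of the contents, so this sum is infinite. The scale m near
  2 \<gamma> n is the one at which the oscillation on a grid interval, about 2^(m/2), equals the
  width 2^(\<gamma> n) of the region: coarser grids waste length, finer ones waste
  intervals.\<close>

definition gauss :: "real measure" where
  "gauss = density lborel (\<lambda>x. ennreal (std_normal_density x))"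

lemma sets_gauss [simp, measurable_cong]: "sets gauss = sets borel"
  by (simp add: gauss_def)

lemma space_gauss [simp]: "space gauss = UNIV"
  by (simp add: gauss_def)

interpretation gauss: prob_space gauss
  unfolding gauss_def by (rule prob_space_normal_density) simp

lemma emeasure_gauss:
  "A \<in> sets borel \<Longrightarrow> emeasure gauss A = (\<integral>\<^sup>+x. ennreal (std_normal_density x) * indicator A x \<partial>lborel)"
  by (simp add: gauss_def emeasure_density)

lemma gauss_le:
  assumes "A \<in> sets borel" "bounded A" "0 \<le> c"
    and "\<And>x. x \<in> A \<Longrightarrow> std_normal_density x \<le> c"
  shows "measure gauss A \<le> c * measure lborel A"
proof -
  have "emeasure gauss A \<le> (\<integral>\<^sup>+x. ennreal c * indicator A x \<partial>lborel)"
    unfolding emeasure_gauss[OF assms(1)]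
    by (intro nn_integral_mono) (auto simp: assms(4) ennreal_leI split: split_indicator)
  also have "\<dots> = ennreal (c * measure lborel A)"
    using assms emeasure_bounded_finite[OF assms(2)]
    by (simp add: nn_integral_cmult_indicator emeasure_eq_ennreal_measure ennreal_mult)
  finally show ?thesis
    using assms(3) by (simp add: gauss.emeasure_eq_measure)
qed

lemma gauss_ge:
  assumes "A \<in> sets borel" "bounded A" "0 \<le> c"
    and "\<And>x. x \<in> A \<Longrightarrow> c \<le> std_normal_density x"
  shows "c * measure lborel A \<le> measure gauss A"
proof -
  have "ennreal (c * measure lborel A) = (\<integral>\<^sup>+x. ennreal c * indicator A x \<partial>lborel)"
    using assms emeasure_bounded_finite[OF assms(2)]
    by (simp add: nn_integral_cmult_indicator emeasure_eq_ennreal_measure ennreal_mult)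
  also have "\<dots> \<le> emeasure gauss A"
    unfolding emeasure_gauss[OF assms(1)]
    by (intro nn_integral_mono) (auto simp: assms(4) ennreal_leI split: split_indicator)
  finally show ?thesis
    by (simp add: gauss.emeasure_eq_measure)
qed

lemma std_normal_density_mono_abs:
  "\<bar>x\<bar> \<le> \<bar>y\<bar> \<Longrightarrow> std_normal_density y \<le> std_normal_density x"
  using power_mono[of "\<bar>x\<bar>" "\<bar>y\<bar>" 2] by (simp add: std_normal_density_def divide_right_mono)

text \<open>The maximum is 1 / sqrt (2 pi), just below 0.4. The rounder 1/2 cancels the length 2u of
  \<open>{-u..u}\<close> and leaves the clean bound \<open>gauss_ball u \<le> u\<close>.\<close>

lemma std_normal_density_le_half: "std_normal_density x \<le> 1/2"
proof -
  have "2 \<le> sqrt (2 * pi)"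
    using pi_gt3 by (intro real_le_rsqrt) auto
  moreover have "exp (- x\<^sup>2 / 2) \<le> 1" by simp
  ultimately have "exp (- x\<^sup>2 / 2) / sqrt (2 * pi) \<le> 1 / 2"
    by (intro frac_le) auto
  thus ?thesis
    by (simp add: std_normal_density_def)
qed

text \<open>By monotonicity only the value at 1 matters: exp (-1/2) is at least 1/2 and sqrt (2 pi)
  at most 3. Multiplied by the length 2u this gives the u / 3 of
  \<open>gauss_ball_ge\<close>.\<close>

lemma std_normal_density_ge_sixth: "\<bar>x\<bar> \<le> 1 \<Longrightarrow> 1/6 \<le> std_normal_density x"
proof -
  assume "\<bar>x\<bar> \<le> 1"
  have "1 + - (1/2) \<le> exp (- (1/2)::real)" by (rule exp_ge_add_one_self)
  hence e: "exp (- (1/2)) \<ge> (1/2::real)" by simp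
  have "sqrt (2 * pi) \<le> 3"
    using pi_less_4 by (intro real_le_lsqrt) auto
  hence "1/6 \<le> std_normal_density 1"
    unfolding std_normal_density_def using e by (auto simp: field_simps)
  also have "\<dots> \<le> std_normal_density x"
    using \<open>\<bar>x\<bar> \<le> 1\<close> by (intro std_normal_density_mono_abs) simp
  finally show ?thesis .
qed

text \<open>By Brownian scaling the event \<open>\<bar>B t\<bar> \<le> a\<close> has probability
  \<open>gauss_ball (a / sqrt t)\<close>. For negative u the interval is empty and the value 0,
  which keeps monotonicity free of sign conditions.\<close>

definition gauss_ball :: "real \<Rightarrow> real" where
  "gauss_ball u = measure gauss {-u..u}"

lemma gauss_ball_nonneg: "0 \<le> gauss_ball u"
  by (simp add: gauss_ball_def)

lemma gauss_ball_mono: "u \<le> v \<Longrightarrow> gauss_ball u \<le> gauss_ball v"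
  unfolding gauss_ball_def by (intro gauss.finite_measure_mono) auto

lemma gauss_ball_le:
  assumes "0 \<le> u" shows "gauss_ball u \<le> u"
  using gauss_le[of "{-u..u}" "1/2"] assms std_normal_density_le_half
  by (simp add: gauss_ball_def)

lemma gauss_ball_ge:
  assumes "0 \<le> u" "u \<le> 1" shows "u / 3 \<le> gauss_ball u"
  using gauss_ge[of "{-u..u}" "1/6"] assms std_normal_density_ge_sixth
  by (simp add: gauss_ball_def abs_le_iff)

text \<open>The difference is the mass of two strips of total length 2 (u - v). It prepares the
  covariance bound, where the chance of a hit after k - j units of time is compared with the chance
  after k units.\<close>

lemma gauss_ball_diff_le:
  assumes "0 \<le> v" "v \<le> u" shows "gauss_ball u - gauss_ball v \<le> u - v"
proof -
  have "gauss_ball u - gauss_ball v = measure gauss ({-u..u} - {-v..v})"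
    unfolding gauss_ball_def using assms by (intro gauss.finite_measure_Diff[symmetric]) auto
  also have "\<dots> \<le> 1/2 * measure lborel ({-u..u} - {-v..v})"
    using std_normal_density_le_half by (intro gauss_le) (auto intro: bounded_subset[of "{-u..u}"])
  also have "measure lborel ({-u..u} - {-v..v}) = measure lborel {-u..u} - measure lborel {-v..v}"
    using assms by (intro measure_Diff) auto
  finally show ?thesis
    using assms by simp
qed

text \<open>A shifted interval exchanges points near the origin for points further out.\<close>

lemma gauss_shift_le:
  assumes "0 \<le> u" shows "measure gauss {x-u..x+u} \<le> gauss_ball u"
proof -
  let ?A = "{x-u..x+u}" and ?D = "{-u..u}" and ?c = "std_normal_density u"
  have bdd: "bounded (?A - ?D)" "bounded (?D - ?A)"
    by (auto intro: bounded_subset[of ?A] bounded_subset[of ?D])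
  have "measure lborel (?A - ?D) = measure lborel (?D - ?A)"
  proof -
    have "measure lborel (?A - ?D) = measure lborel ?A - measure lborel (?A \<inter> ?D)"
      using assms by (subst measure_Diff[symmetric]) (auto simp: Diff_Int_distrib intro: arg_cong)
    moreover have "measure lborel (?D - ?A) = measure lborel ?D - measure lborel (?A \<inter> ?D)"
      using assms by (subst measure_Diff[symmetric]) (auto intro: arg_cong)
    ultimately show ?thesis using assms by simp
  qed
  moreover have "measure gauss (?A - ?D) \<le> ?c * measure lborel (?A - ?D)"
    using assms bdd by (intro gauss_le std_normal_density_mono_abs) auto
  moreover have "?c * measure lborel (?D - ?A) \<le> measure gauss (?D - ?A)"
    using assms bdd by (intro gauss_ge std_normal_density_mono_abs) auto
  moreover have "measure gauss ?A = measure gauss (?A - ?D) + measure gauss (?A \<inter> ?D)"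
    by (subst gauss.finite_measure_Union[symmetric]) (auto intro: arg_cong)
  moreover have "measure gauss ?D = measure gauss (?D - ?A) + measure gauss (?A \<inter> ?D)"
    by (subst gauss.finite_measure_Union[symmetric]) (auto intro: arg_cong)
  ultimately show ?thesis
    by (simp add: gauss_ball_def)
qed

text \<open>Markov's inequality for the moment of order 2p. A polynomial rate is enough because p
  stays free: it is later chosen large enough to beat the number of intervals in a union
  bound.\<close>

lemma gauss_tail:
  fixes p :: nat
  obtains C where "0 \<le> C" "\<And>u. 0 < u \<Longrightarrow> measure gauss {x. u < \<bar>x\<bar>} \<le> C / u ^ (2 * p)"
proof -
  define C where "C = (fact (2 * p) / (2 ^ p * fact p) :: real)"
  have mom: "has_bochner_integral gauss (\<lambda>x. x ^ (2 * p)) C"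
    unfolding gauss_def C_def using std_normal_moment_even[of p]
    by (intro has_bochner_integral_density) auto
  have "measure gauss {x. u < \<bar>x\<bar>} \<le> C / u ^ (2 * p)" if "0 < u" for u
  proof -
    have "measure gauss {x. u < \<bar>x\<bar>} \<le> measure gauss {x\<in>space gauss. u ^ (2 * p) \<le> x ^ (2 * p)}"
    proof (rule gauss.finite_measure_mono)
      show "{x. u < \<bar>x\<bar>} \<subseteq> {x\<in>space gauss. u ^ (2 * p) \<le> x ^ (2 * p)}"
        using that by (auto simp: power_mult intro!: power_mono abs_le_square_iff[THEN iffD1])
    qed simp
    also have "\<dots> \<le> C / u ^ (2 * p)"
      using integral_Markov_inequality_measure[of gauss "\<lambda>x. x ^ (2*p)" "space gauss" "u ^ (2*p)"]
        mom that by (simp add: has_bochner_integral_iff)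
    finally show ?thesis .
  qed
  moreover have "0 \<le> C" by (simp add: C_def)
  ultimately show ?thesis using that by blast
qed

section \<open>Two-time estimates for Brownian motion\<close>

locale brownian = prob_space M for M :: "'a measure" +
  fixes B :: "'a \<Rightarrow> real \<Rightarrow> real"
  assumes brownian: "brownian_motion M B"
begin

lemma B_measurable [measurable]: "0 \<le> t \<Longrightarrow> (\<lambda>\<omega>. B \<omega> t) \<in> borel_measurable M"
  using brownian by (simp add: brownian_motion_def)

lemma AE_path: "AE \<omega> in M. B \<omega> 0 = 0 \<and> continuous_on {0..} (B \<omega>)"
  using brownian by (simp add: brownian_motion_def)

lemma increment_prob:
  assumes "0 \<le> s" "s < t" and [measurable]: "A \<in> sets borel"
  shows "prob {\<omega>\<in>space M. (B \<omega> t - B \<omega> s) / sqrt (t - s) \<in> A} = measure gauss A"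
proof -
  let ?X = "\<lambda>\<omega>. (B \<omega> t - B \<omega> s) / sqrt (t - s)"
  have "distributed M lborel (\<lambda>\<omega>. B \<omega> t - B \<omega> s) (\<lambda>x. ennreal (normal_density 0 (sqrt (t - s)) x))"
    using brownian assms by (simp add: brownian_motion_def)
  hence d: "distributed M lborel ?X std_normal_density"
    using normal_standard_normal_convert[of "sqrt (t - s)" "\<lambda>\<omega>. B \<omega> t - B \<omega> s" 0] assms by simp
  have m: "?X \<in> measurable M lborel"
    using distributed_measurable[OF d] .
  have "measure gauss A = measure (distr M lborel ?X) A"
    using distributed_distr_eq_density[OF d] by (simp add: gauss_def)
  also have "\<dots> = prob (?X -` A \<inter> space M)"
    using m by (subst measure_distr) auto
  also have "?X -` A \<inter> space M = {\<omega>\<in>space M. ?X \<omega> \<in> A}" by auto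
  finally show ?thesis by simp
qed

text \<open>The number x stands for the position at time s. The bound is uniform in x because the
  centred interval has the largest Gaussian mass among those of its length.\<close>

lemma increment_shift_le:
  assumes "0 \<le> s" "s < t" "0 \<le> b"
  shows "prob {\<omega>\<in>space M. \<bar>x + (B \<omega> t - B \<omega> s)\<bar> \<le> b} \<le> gauss_ball (b / sqrt (t - s))"
proof -
  let ?r = "sqrt (t - s)"
  have r: "?r > 0" using assms by simp
  have "{\<omega>\<in>space M. \<bar>x + (B \<omega> t - B \<omega> s)\<bar> \<le> b} =
      {\<omega>\<in>space M. (B \<omega> t - B \<omega> s) / ?r \<in> {(-x/?r) - b/?r..(-x/?r) + b/?r}}"
  proof -
    have e: "-x/?r - b/?r = (-x - b)/?r" "-x/?r + b/?r = (-x + b)/?r"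
      by (simp_all add: diff_divide_distrib add_divide_distrib)
    show ?thesis
      unfolding e using r by (auto simp: divide_le_cancel)
  qed
  hence "prob {\<omega>\<in>space M. \<bar>x + (B \<omega> t - B \<omega> s)\<bar> \<le> b} = measure gauss {(-x/?r) - b/?r..(-x/?r) + b/?r}"
    using increment_prob[OF assms(1,2), of "{(-x/?r) - b/?r..(-x/?r) + b/?r}"] by simp
  also have "\<dots> \<le> gauss_ball (b / ?r)"
    using assms by (intro gauss_shift_le) simp
  finally show ?thesis .
qed

lemma prob_abs_le:
  assumes "0 < t"
  shows "prob {\<omega>\<in>space M. \<bar>B \<omega> t\<bar> \<le> b} = gauss_ball (b / sqrt t)"
proof -
  have [measurable]: "(\<lambda>\<omega>. B \<omega> t) \<in> borel_measurable M" "(\<lambda>\<omega>. B \<omega> 0) \<in> borel_measurable M"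
    using assms by auto
  have "prob {\<omega>\<in>space M. \<bar>B \<omega> t\<bar> \<le> b} =
      prob {\<omega>\<in>space M. (B \<omega> t - B \<omega> 0) / sqrt (t - 0) \<in> {-(b / sqrt t)..b / sqrt t}}"
  proof (rule finite_measure_eq_AE)
    show "AE \<omega> in M. (\<omega> \<in> {\<omega> \<in> space M. \<bar>B \<omega> t\<bar> \<le> b}) =
      (\<omega> \<in> {\<omega>\<in>space M. (B \<omega> t - B \<omega> 0) / sqrt (t - 0) \<in> {-(b / sqrt t)..b / sqrt t}})"
      using AE_path
    proof eventually_elim
      case (elim \<omega>)
      then show ?case using assms by (auto simp: field_simps abs_le_iff)
    qed
  qed simp_all
  also have "\<dots> = gauss_ball (b / sqrt t)"
    unfolding gauss_ball_def by (rule increment_prob) (use assms in auto)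
  finally show ?thesis .
qed

lemma indep_increment:
  assumes "0 < s" "s < t"
  shows "indep_var borel (\<lambda>\<omega>. B \<omega> s - B \<omega> 0) borel (\<lambda>\<omega>. B \<omega> t - B \<omega> s)"
proof -
  have "prob_space.indep_vars M (\<lambda>_. borel)
     (\<lambda>i \<omega>. B \<omega> ([0, s, t] ! Suc i) - B \<omega> ([0, s, t] ! i)) {..<length [0, s, t] - 1}"
    using brownian assms unfolding brownian_motion_def by (elim conjE allE[of _ "[0,s,t]"]) auto
  hence "indep_vars (\<lambda>_. borel) (\<lambda>i \<omega>. B \<omega> ([0, s, t] ! Suc i) - B \<omega> ([0, s, t] ! i)) (insert 0 {1})"
    by (rule indep_vars_subset) auto
  \<comment> \<open>The index set was written as \<open>insert 0 {1}\<close> because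
    \<open>indep_vars_sum\<close> separates one index from the sum over the others; here that sum
    has a single term.\<close>
  from indep_vars_sum[OF _ _ this] show ?thesis by simp
qed

text \<open>Fubini for the joint law of the two independent increments: for each admissible position
  x at time s the section in the second increment is an interval of half-length b, whose mass
  \<open>increment_shift_le\<close> bounds uniformly in x. That t - s and not t enters the second
  factor is the source of all correlations estimated later.\<close>

lemma prob_two_times_le:
  assumes "0 < s" "s < t" "0 \<le> b"
  shows "prob {\<omega>\<in>space M. \<bar>B \<omega> s\<bar> \<le> a \<and> \<bar>B \<omega> t\<bar> \<le> b} \<le>
    gauss_ball (a / sqrt s) * gauss_ball (b / sqrt (t - s))"
proof -
  let ?X = "\<lambda>\<omega>. B \<omega> s - B \<omega> 0" and ?Y = "\<lambda>\<omega>. B \<omega> t - B \<omega> s"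
  let ?c = "gauss_ball (b / sqrt (t - s))"
  define S where "S = {p. \<bar>fst p\<bar> \<le> a \<and> \<bar>fst p + snd p\<bar> \<le> (b::real)}"
  have S[measurable]: "S \<in> sets (borel \<Otimes>\<^sub>M borel)"
  proof -
    have "S = {p\<in>space (borel \<Otimes>\<^sub>M borel). \<bar>fst p\<bar> \<le> a \<and> \<bar>fst p + snd p\<bar> \<le> b}"
      by (auto simp: S_def space_pair_measure)
    thus ?thesis by simp
  qed
  have [measurable]: "?X \<in> borel_measurable M" "?Y \<in> borel_measurable M"
      "(\<lambda>\<omega>. B \<omega> s) \<in> borel_measurable M" "(\<lambda>\<omega>. B \<omega> t) \<in> borel_measurable M"
    using assms by auto
  interpret Y: prob_space "distr M borel ?Y" by (rule prob_space_distr) simp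
  \<comment> \<open>The path starts at 0 only almost surely, so events stated through
    \<open>B\<close> and through its increments agree up to a null set.\<close>
  have *: "prob {\<omega>\<in>space M. \<bar>B \<omega> s\<bar> \<le> a \<and> \<bar>B \<omega> t\<bar> \<le> b} =
      prob ((\<lambda>\<omega>. (?X \<omega>, ?Y \<omega>)) -` S \<inter> space M)"
  proof (rule finite_measure_eq_AE)
    show "AE \<omega> in M. (\<omega> \<in> {\<omega>\<in>space M. \<bar>B \<omega> s\<bar> \<le> a \<and> \<bar>B \<omega> t\<bar> \<le> b}) =
       (\<omega> \<in> (\<lambda>\<omega>. (?X \<omega>, ?Y \<omega>)) -` S \<inter> space M)"
      using AE_path by eventually_elim (auto simp: S_def)
  qed simp_all
  have "ennreal (prob ((\<lambda>\<omega>. (?X \<omega>, ?Y \<omega>)) -` S \<inter> space M)) =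
      emeasure (distr M (borel \<Otimes>\<^sub>M borel) (\<lambda>\<omega>. (?X \<omega>, ?Y \<omega>))) S"
    by (subst emeasure_distr) (auto simp: emeasure_eq_measure)
  also have "\<dots> = emeasure (distr M borel ?X \<Otimes>\<^sub>M distr M borel ?Y) S"
    using indep_increment[OF assms(1,2)] by (simp add: indep_var_distribution_eq)
  also have "\<dots> = (\<integral>\<^sup>+x. emeasure (distr M borel ?Y) (Pair x -` S) \<partial>distr M borel ?X)"
    by (rule Y.emeasure_pair_measure_alt) (metis S sets_distr sets_pair_measure_cong)
  also have "\<dots> \<le> (\<integral>\<^sup>+x. ennreal ?c * indicator {x. \<bar>x\<bar> \<le> a} x \<partial>distr M borel ?X)"
  proof (rule nn_integral_mono)
    fix x
    show "emeasure (distr M borel ?Y) (Pair x -` S) \<le> ennreal ?c * indicator {x. \<bar>x\<bar> \<le> a} x"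
    proof (cases "\<bar>x\<bar> \<le> a")
      case True
      have "Pair x -` S = {y. \<bar>x + y\<bar> \<le> b}" using True by (auto simp: S_def)
      hence "emeasure (distr M borel ?Y) (Pair x -` S) = prob {\<omega>\<in>space M. \<bar>x + ?Y \<omega>\<bar> \<le> b}"
        by (simp, subst emeasure_distr) (auto simp: emeasure_eq_measure intro!: arg_cong[where f=prob])
      also have "\<dots> \<le> ?c" using increment_shift_le[of s t b x] assms by (simp add: ennreal_leI)
      finally show ?thesis using True by simp
    next
      case False
      hence "Pair x -` S = {}" by (auto simp: S_def)
      thus ?thesis by simp
    qed
  qed
  also have "\<dots> = ennreal ?c * emeasure (distr M borel ?X) {x. \<bar>x\<bar> \<le> a}"
    by (subst nn_integral_cmult_indicator) auto
  also have "emeasure (distr M borel ?X) {x. \<bar>x\<bar> \<le> a} = prob {\<omega>\<in>space M. \<bar>?X \<omega>\<bar> \<le> a}"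
    by (subst emeasure_distr) (auto simp: emeasure_eq_measure intro!: arg_cong[where f=prob])
  also have "prob {\<omega>\<in>space M. \<bar>?X \<omega>\<bar> \<le> a} = prob {\<omega>\<in>space M. \<bar>B \<omega> s\<bar> \<le> a}"
  proof (rule finite_measure_eq_AE)
    show "AE \<omega> in M. (\<omega> \<in> {\<omega>\<in>space M. \<bar>?X \<omega>\<bar> \<le> a}) = (\<omega> \<in> {\<omega>\<in>space M. \<bar>B \<omega> s\<bar> \<le> a})"
      using AE_path by eventually_elim auto
  qed simp_all
  also have "\<dots> = gauss_ball (a / sqrt s)" by (rule prob_abs_le) fact
  finally have "ennreal (prob ((\<lambda>\<omega>. (?X \<omega>, ?Y \<omega>)) -` S \<inter> space M)) \<le> ennreal (?c * gauss_ball (a / sqrt s))"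
    by (simp add: ennreal_mult gauss_ball_nonneg)
  thus ?thesis unfolding *
    by (subst (asm) ennreal_le_iff) (auto simp: gauss_ball_nonneg mult.commute)
qed

lemma increment_tail:
  assumes "0 \<le> s" "s < t" "0 \<le> u"
  shows "prob {\<omega>\<in>space M. u * sqrt (t - s) < \<bar>B \<omega> t - B \<omega> s\<bar>} = measure gauss {x. u < \<bar>x\<bar>}"
proof -
  have "{\<omega>\<in>space M. u * sqrt (t - s) < \<bar>B \<omega> t - B \<omega> s\<bar>} =
      {\<omega>\<in>space M. (B \<omega> t - B \<omega> s) / sqrt (t - s) \<in> {x. u < \<bar>x\<bar>}}"
    using assms by (auto simp: field_simps abs_divide)
  thus ?thesis using increment_prob[of s t "{x. u < \<bar>x\<bar>}"] assms by simp
qed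

text \<open>Markov's inequality followed by Borel-Cantelli. It serves for normalised quantities: a
  count, a squared deviation or an energy sum, divided by the bound that it should eventually
  obey.\<close>

lemma AE_eventually_less_one:
  fixes Z :: "nat \<Rightarrow> 'a \<Rightarrow> real"
  assumes int: "\<And>i. integrable M (Z i)" and nn: "\<And>i \<omega>. \<omega> \<in> space M \<Longrightarrow> 0 \<le> Z i \<omega>"
    and ev: "eventually (\<lambda>i. expectation (Z i) \<le> c i) sequentially" and c: "summable c"
  shows "AE \<omega> in M. eventually (\<lambda>i. Z i \<omega> < 1) sequentially"
proof -
  have "AE \<omega> in M. eventually (\<lambda>i. \<omega> \<in> space M - {\<omega>\<in>space M. Z i \<omega> \<ge> 1}) sequentially"
  proof (rule borel_cantelli_AE1)
    show "{\<omega>\<in>space M. Z i \<omega> \<ge> 1} \<in> sets M" for i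
      using borel_measurable_integrable[OF int[of i]] by measurable
    have "prob {\<omega>\<in>space M. Z i \<omega> \<ge> 1} \<le> expectation (Z i)" for i
      using integral_Markov_inequality_measure[OF int[of i], of "space M" 1] nn
      by (auto intro: AE_I2)
    hence "eventually (\<lambda>i. norm (prob {\<omega>\<in>space M. Z i \<omega> \<ge> 1}) \<le> c i) sequentially"
      by (intro eventually_mono[OF ev]) (auto intro: order_trans)
    thus "summable (\<lambda>i. prob {\<omega>\<in>space M. Z i \<omega> \<ge> 1})"
      using c by (rule summable_comparison_test_ev)
  qed (auto simp: emeasure_eq_measure)
  thus ?thesis
    by (rule AE_mp) (auto intro!: AE_I2 elim: eventually_mono)
qed

end

section \<open>Oscillation\<close>

text \<open>The dyadic truncations of t within the interval start at a and converge to t. Two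
  consecutive ones coincide or are neighbours in the finer grid, so the increments are dominated by
  a geometric series, and continuity passes the bound on to t.\<close>

lemma dyadic_chaining:
  fixes f :: "real \<Rightarrow> real"
  assumes cont: "continuous_on {a..a+L} f" and L: "0 < L" and r: "0 \<le> r" "r < 1" and c: "0 \<le> c"
    and step: "\<And>i k. k < 2 ^ i \<Longrightarrow>
      \<bar>f (a + real (Suc k) * L / 2 ^ i) - f (a + real k * L / 2 ^ i)\<bar> \<le> c * r ^ i"
    and t: "t \<in> {a..a+L}"
  shows "\<bar>f t - f a\<bar> \<le> c / (1 - r)"
proof (cases "t = a + L")
  \<comment> \<open>At the right end the truncation index would be \<open>2 ^ i\<close>, outside the
    range of \<open>step\<close>; the whole interval is a single step of level 0.\<close>
  case True
  have "\<bar>f t - f a\<bar> \<le> c" using step[of 0 0] True by simp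
  also have "c * (1 - r) \<le> c * 1" using r c by (intro mult_left_mono) auto
  hence "c \<le> c / (1 - r)" using r by (simp add: field_simps)
  finally show ?thesis .
next
  case False
  define x where "x = (t - a) / L"
  have x: "0 \<le> x" "x < 1" using t False L by (auto simp: x_def field_simps)
  have tx: "t = a + x * L" using L by (simp add: x_def)
  define k where "k i = nat \<lfloor>x * 2 ^ i\<rfloor>" for i :: nat
  define d where "d i = a + real (k i) * L / 2 ^ i" for i :: nat
  have k_le: "real (k i) \<le> x * 2 ^ i" for i
    using x by (simp add: k_def)
  have k_gt: "x * 2 ^ i < real (k i) + 1" for i
    using x unfolding k_def by linarith
  have k_less: "k i < 2 ^ i" for i
  proof -
    have "x * 2 ^ i < 1 * (2::real) ^ i"
      by (intro mult_strict_right_mono x) simp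
    hence "real (k i) < 2 ^ i"
      using k_le[of i] by linarith
    thus ?thesis by (metis of_nat_less_iff of_nat_numeral of_nat_power)
  qed
  \<comment> \<open>The two alternatives are the values 0 and 1 of the next binary digit of
    x.\<close>
  have k_Suc: "k (Suc i) = 2 * k i \<or> k (Suc i) = Suc (2 * k i)" for i
  proof -
    have "real (2 * k i) < real (Suc (k (Suc i)))" "real (k (Suc i)) < real (2 * k i + 2)"
      using k_le[of i] k_gt[of i] k_le[of "Suc i"] k_gt[of "Suc i"] by auto
    hence "2 * k i < Suc (k (Suc i))" "k (Suc i) < 2 * k i + 2"
      by (simp_all only: of_nat_less_iff)
    thus ?thesis by linarith
  qed
  have d_step: "\<bar>f (d (Suc i)) - f (d i)\<bar> \<le> c * r ^ Suc i" for i
  proof -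
    have di: "d i = a + real (2 * k i) * L / 2 ^ Suc i" by (simp add: d_def)
    show ?thesis
    proof (cases "k (Suc i) = 2 * k i")
      case True
      hence "d (Suc i) = d i" by (simp add: d_def)
      thus ?thesis using r c by simp
    next
      case False
      hence eq: "k (Suc i) = Suc (2 * k i)" using k_Suc[of i] by simp
      have "2 * k i < 2 ^ Suc i" using k_less[of "Suc i"] eq by simp
      from step[OF this] show ?thesis unfolding di unfolding d_def eq .
    qed
  qed
  have d_bound: "\<bar>f (d i) - f a\<bar> \<le> c * (\<Sum>l<Suc i. r ^ l)" for i
  proof (induction i)
    case 0
    have "k 0 = 0" using k_less[of 0] by simp
    thus ?case using c by (simp add: d_def)
  next
    case (Suc i)
    have "\<bar>f (d (Suc i)) - f a\<bar> \<le> c * r ^ Suc i + c * (\<Sum>l<Suc i. r ^ l)"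
      using Suc d_step[of i] by linarith
    thus ?case by (simp add: algebra_simps)
  qed
  have "(\<Sum>l<Suc i. r ^ l) \<le> 1 / (1 - r)" for i
  proof -
    have "(\<Sum>l<Suc i. r ^ l) = (1 - r ^ Suc i) / (1 - r)"
      using r geometric_sum[of r "Suc i"] by (simp add: field_simps)
    also have "\<dots> \<le> 1 / (1 - r)" using r by (intro divide_right_mono) auto
    finally show ?thesis .
  qed
  hence "c * (\<Sum>l<Suc i. r ^ l) \<le> c * (1 / (1 - r))" for i
    by (intro mult_left_mono c)
  hence d_bound': "\<bar>f (d i) - f a\<bar> \<le> c / (1 - r)" for i
    using order_trans[OF d_bound[of i]] by simp
  have d_in: "d i \<in> {a..a+L}" for i
  proof -
    have "real (k i) \<le> real (2 ^ i)"
      using k_less[of i] by (simp only: of_nat_le_iff less_imp_le)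
    hence "real (k i) * L / 2 ^ i \<le> L"
      using L by (simp add: field_simps)
    thus ?thesis using L by (auto simp: d_def)
  qed
  have "d \<longlonglongrightarrow> t"
  proof (rule LIMSEQ_I)
    fix e :: real assume "0 < e"
    hence "\<exists>n. L * (1/2) ^ n < e"
      using real_arch_pow_inv[of "e / L" "1/2"] L by (auto simp: field_simps)
    then obtain n where n: "L * (1/2) ^ n < e" by blast
    have "norm (d i - t) < e" if "i \<ge> n" for i
    proof -
      have "t - d i = (x * 2 ^ i - real (k i)) * (L / 2 ^ i)"
        by (simp add: tx d_def field_simps)
      moreover have "0 \<le> (x * 2 ^ i - real (k i)) * (L / 2 ^ i)"
        using k_le[of i] L by (intro mult_nonneg_nonneg) auto
      moreover have "(x * 2 ^ i - real (k i)) * (L / 2 ^ i) \<le> 1 * (L / 2 ^ i)"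
        using k_gt[of i] L by (intro mult_right_mono) auto
      moreover have "L / 2 ^ i \<le> L * (1/2) ^ n"
        using L power_decreasing[OF that, of "1/2::real"] by (simp add: power_one_over field_simps)
      ultimately show ?thesis using n by simp
    qed
    thus "\<exists>n. \<forall>i\<ge>n. norm (d i - t) < e" by blast
  qed
  hence "(\<lambda>i. f (d i)) \<longlonglongrightarrow> f t"
    by (rule continuous_on_tendsto_compose[OF cont]) (use t d_in in auto)
  hence "(\<lambda>i. \<bar>f (d i) - f a\<bar>) \<longlonglongrightarrow> \<bar>f t - f a\<bar>"
    by (intro tendsto_intros)
  thus ?thesis
    using d_bound' by (intro LIMSEQ_le_const2) auto
qed

context brownian begin

text \<open>Level i of the chaining allows increments up to \<open>u * sqrt L * (3/4) ^ i\<close>,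
  while their standard deviation is \<open>sqrt (L / 2 ^ i)\<close>. As 3/4 exceeds 1 / sqrt 2, the
  ratio v grows: \<open>v ^ 2 = u ^ 2 * (9/8) ^ i\<close>. From p = 12 on, \<open>(9/8) ^ p\<close>
  is at least 4, and the tail gains \<open>4 ^ i\<close> against the \<open>2 ^ i\<close> increments
  of the level. The 4 in the conclusion is 1 / (1 - 3/4). The exceptional event involves dyadic
  times only, which settles its measurability.\<close>

lemma oscillation_prob:
  fixes p :: nat
  assumes p: "12 \<le> p"
  obtains C where "0 \<le> C" "\<And>s L u. 0 \<le> s \<Longrightarrow> 0 < L \<Longrightarrow> 0 < u \<Longrightarrow>
    \<exists>A\<in>events. prob A \<le> C / u ^ (2 * p) \<and> (\<forall>\<omega>\<in>space M - A. continuous_on {0..} (B \<omega>) \<longrightarrow>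
      (\<forall>t\<in>{s..s+L}. \<bar>B \<omega> t - B \<omega> s\<bar> \<le> 4 * u * sqrt L))"
proof -
  obtain C where C: "0 \<le> C" "\<And>u. 0 < u \<Longrightarrow> measure gauss {x. u < \<bar>x\<bar>} \<le> C / u ^ (2 * p)"
    using gauss_tail[of p] by blast
  have "\<exists>A\<in>events. prob A \<le> (2 * C) / u ^ (2 * p) \<and> (\<forall>\<omega>\<in>space M - A. continuous_on {0..} (B \<omega>) \<longrightarrow>
      (\<forall>t\<in>{s..s+L}. \<bar>B \<omega> t - B \<omega> s\<bar> \<le> 4 * u * sqrt L))"
    if s: "0 \<le> s" and L: "0 < L" and u: "0 < u" for s L u
  proof -
    let ?t = "\<lambda>i k. s + real k * L / 2 ^ i"
    define D where "D i k = {\<omega>\<in>space M. u * sqrt L * (3/4) ^ i < \<bar>B \<omega> (?t i (Suc k)) - B \<omega> (?t i k)\<bar>}" for i k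
    define A where "A i = (\<Union>k<2 ^ i. D i k)" for i :: nat
    have D_ev: "D i k \<in> events" for i k
    proof -
      have [measurable]: "(\<lambda>\<omega>. B \<omega> (?t i k)) \<in> borel_measurable M" "(\<lambda>\<omega>. B \<omega> (?t i (Suc k))) \<in> borel_measurable M"
        using s L by auto
      show ?thesis unfolding D_def by measurable
    qed
    hence A_ev: "A i \<in> events" for i by (auto simp: A_def)
    have D_prob: "prob (D i k) \<le> C / u ^ (2 * p) * (1/4) ^ i" for i k
    proof -
      define v where "v = u * sqrt (2 ^ i) * (3/4) ^ i"
      have v: "0 < v" using u by (simp add: v_def)
      have dt: "?t i (Suc k) - ?t i k = L / 2 ^ i" by (simp add: field_simps)
      have "v * sqrt (?t i (Suc k) - ?t i k) = u * sqrt L * (3/4) ^ i"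
        unfolding dt v_def by (simp add: real_sqrt_divide)
      moreover have "?t i k < ?t i (Suc k)"
        using L dt by (metis diff_gt_0_iff_gt divide_pos_pos zero_less_numeral zero_less_power)
      ultimately have "prob (D i k) = measure gauss {x. v < \<bar>x\<bar>}"
        using increment_tail[of "?t i k" "?t i (Suc k)" v] s L v by (simp add: D_def)
      also have "\<dots> \<le> C / v ^ (2 * p)" by (rule C) fact
      also have "v ^ (2 * p) = u ^ (2 * p) * ((9/8) ^ p) ^ i"
      proof -
        have "v ^ 2 = u ^ 2 * (2 ^ i * ((3/4) ^ i) ^ 2)" by (simp add: v_def power_mult_distrib)
        also have "2 ^ i * ((3/4) ^ i) ^ 2 = (9/8::real) ^ i"
          by (simp add: power_mult_distrib[symmetric] power2_eq_square)
        finally have "v ^ 2 = u ^ 2 * (9/8) ^ i" .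
        hence "(v ^ 2) ^ p = (u ^ 2) ^ p * ((9/8) ^ i) ^ p" by (simp add: power_mult_distrib)
        thus ?thesis by (simp add: mult.commute flip: power_mult)
      qed
      also have "C / (u ^ (2 * p) * ((9/8) ^ p) ^ i) \<le> C / (u ^ (2 * p) * 4 ^ i)"
      proof -
        have "(4::real) \<le> (9/8) ^ 12" by (simp add: power_divide)
        also have "\<dots> \<le> (9/8) ^ p" using p by (intro power_increasing) auto
        finally have "(4::real) ^ i \<le> ((9/8) ^ p) ^ i" by (intro power_mono) auto
        thus ?thesis using C u by (intro divide_left_mono mult_left_mono mult_pos_pos) auto
      qed
      finally show ?thesis by (simp add: power_one_over)
    qed
    have A_prob: "prob (A i) \<le> C / u ^ (2 * p) * (1/2) ^ i" for i
    proof -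
      have "prob (A i) \<le> (\<Sum>k<2 ^ i. prob (D i k))"
        unfolding A_def using D_ev by (intro finite_measure_subadditive_finite) auto
      also have "\<dots> \<le> (\<Sum>k<(2::nat) ^ i. C / u ^ (2 * p) * (1/4) ^ i)"
        by (intro sum_mono D_prob)
      also have "\<dots> = C / u ^ (2 * p) * (2 ^ i * (1/4) ^ i)" by simp
      also have "2 ^ i * (1/4) ^ i = (1/2::real) ^ i"
        by (simp add: power_mult_distrib[symmetric])
      finally show ?thesis .
    qed
    have sm: "summable (\<lambda>i. C / u ^ (2 * p) * (1/2) ^ i)"
      by (intro summable_mult summable_geometric) simp
    have sA: "summable (\<lambda>i. prob (A i))"
    proof (rule summable_comparison_test'[OF sm])
      show "norm (prob (A i)) \<le> C / u ^ (2 * p) * (1/2) ^ i" for i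
        unfolding real_norm_def using A_prob[of i] by (simp only: abs_of_nonneg measure_nonneg)
    qed
    have "prob (\<Union>i. A i) \<le> (\<Sum>i. prob (A i))"
      using A_ev sA by (intro finite_measure_subadditive_countably) auto
    also have "\<dots> \<le> (\<Sum>i. C / u ^ (2 * p) * (1/2) ^ i)"
      by (intro suminf_le A_prob sA sm)
    also have "\<dots> = 2 * C / u ^ (2 * p)"
      by (subst suminf_mult) (auto simp: suminf_geometric)
    finally have "prob (\<Union>i. A i) \<le> 2 * C / u ^ (2 * p)" .
    moreover have "\<bar>B \<omega> t - B \<omega> s\<bar> \<le> 4 * u * sqrt L"
      if "\<omega> \<in> space M - (\<Union>i. A i)" "continuous_on {0..} (B \<omega>)" "t \<in> {s..s+L}" for \<omega> t
    proof -
      have "\<bar>B \<omega> t - B \<omega> s\<bar> \<le> (u * sqrt L) / (1 - 3/4)"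
      proof (rule dyadic_chaining[where f = "B \<omega>" and a = s and L = L and r = "3/4" and c = "u * sqrt L"])
        show "continuous_on {s..s+L} (B \<omega>)"
          using s by (intro continuous_on_subset[OF that(2)]) auto
        show "\<bar>B \<omega> (?t i (Suc k)) - B \<omega> (?t i k)\<bar> \<le> u * sqrt L * (3/4) ^ i" if "k < 2 ^ i" for i k
          using \<open>\<omega> \<in> space M - (\<Union>i. A i)\<close> that by (auto simp: A_def D_def not_less)
      qed (use L u that in auto)
      thus ?thesis by simp
    qed
    moreover have "(\<Union>i. A i) \<in> events" using A_ev by auto
    ultimately show ?thesis by blast
  qed
  thus ?thesis using C(1) that[of "2 * C"] by simp
qed

text \<open>A union bound over \<open>2 ^ n\<close> intervals: once
  \<open>\<epsilon> * p \<ge> 1\<close>, each exceptional probability is at most C times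
  \<open>2 powr (-2 * n)\<close>, which leaves \<open>C * (1/2) ^ n\<close> for Borel-Cantelli.
  Positions and lengths stay free, since both long grid intervals and very short intervals occur
  later.\<close>

lemma AE_oscillation:
  fixes \<epsilon> :: real and s :: "nat \<Rightarrow> nat \<Rightarrow> real" and L :: "nat \<Rightarrow> real"
  assumes eps: "0 < \<epsilon>" and s: "\<And>n j. 0 \<le> s n j" and L: "\<And>n. 0 < L n"
  shows "AE \<omega> in M. eventually (\<lambda>n. \<forall>j<2 ^ n. \<forall>t\<in>{s n j..s n j + L n}.
     \<bar>B \<omega> t - B \<omega> (s n j)\<bar> \<le> 4 * 2 powr (\<epsilon> * n) * sqrt (L n)) sequentially"
proof -
  obtain p0 :: nat where p0: "1 / \<epsilon> \<le> real p0" using real_arch_simple by blast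
  define p where "p = max 12 p0"
  have "1 \<le> \<epsilon> * p0" using p0 eps by (simp add: field_simps)
  also have "\<dots> \<le> \<epsilon> * p" using eps by (simp add: p_def)
  finally have p: "12 \<le> p" "1 \<le> \<epsilon> * p" by (simp_all add: p_def)
  obtain C where C: "0 \<le> C" "\<And>s L u. 0 \<le> s \<Longrightarrow> 0 < L \<Longrightarrow> 0 < u \<Longrightarrow>
    \<exists>A\<in>events. prob A \<le> C / u ^ (2 * p) \<and> (\<forall>\<omega>\<in>space M - A. continuous_on {0..} (B \<omega>) \<longrightarrow>
      (\<forall>t\<in>{s..s+L}. \<bar>B \<omega> t - B \<omega> s\<bar> \<le> 4 * u * sqrt L))"
    using oscillation_prob[OF p(1)] by blast
  have "\<forall>n j. \<exists>A. A \<in> events \<and> prob A \<le> C / (2 powr (\<epsilon> * n)) ^ (2 * p) \<and>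
    (\<forall>\<omega>\<in>space M - A. continuous_on {0..} (B \<omega>) \<longrightarrow>
      (\<forall>t\<in>{s n j..s n j+L n}. \<bar>B \<omega> t - B \<omega> (s n j)\<bar> \<le> 4 * 2 powr (\<epsilon> * n) * sqrt (L n)))"
    using C(2)[OF s L] by (simp add: Bex_def)
  then obtain A where A: "\<And>n j. A n j \<in> events"
    "\<And>(n::nat) j. prob (A n j) \<le> C / (2 powr (\<epsilon> * n)) ^ (2 * p)"
    "\<And>(n::nat) j \<omega> t. \<omega> \<in> space M - A n j \<Longrightarrow> continuous_on {0..} (B \<omega>) \<Longrightarrow> t \<in> {s n j..s n j+L n} \<Longrightarrow>
       \<bar>B \<omega> t - B \<omega> (s n j)\<bar> \<le> 4 * 2 powr (\<epsilon> * n) * sqrt (L n)"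
    by metis
  define U where "U n = (\<Union>j<2 ^ n. A n j)" for n :: nat
  have U_ev: "U n \<in> events" for n using A(1) by (auto simp: U_def)
  have U_prob: "prob (U n) \<le> C * (1/2) ^ n" for n
  proof -
    have "prob (U n) \<le> (\<Sum>j<2 ^ n. prob (A n j))"
      unfolding U_def using A(1) by (intro finite_measure_subadditive_finite) auto
    also have "\<dots> \<le> (\<Sum>j<(2::nat) ^ n. C / (2 powr (\<epsilon> * n)) ^ (2 * p))"
      by (intro sum_mono A)
    also have "\<dots> = C * (2 ^ n / (2 powr (\<epsilon> * n)) ^ (2 * p))" by simp
    also have "(2 powr (\<epsilon> * n)) ^ (2 * p) = 2 powr (2 * n * (\<epsilon> * p))"
      by (simp add: powr_powr mult_ac flip: powr_realpow)
    also have "C * (2 ^ n / 2 powr (2 * n * (\<epsilon> * p))) \<le> C * (2 ^ n / 2 powr (2 * n))"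
    proof -
      have "2 * real n * 1 \<le> 2 * real n * (\<epsilon> * p)"
        using p by (intro mult_left_mono) auto
      thus ?thesis using C(1) by (intro mult_left_mono divide_left_mono) (auto simp: powr_mono)
    qed
    also have "(2::real) ^ n / 2 powr (2 * n) = (1/2) ^ n"
    proof -
      have "(2::real) powr (2 * n) = 2 ^ n * 2 ^ n"
        using powr_add[of "2::real" n n] by (simp add: powr_realpow)
      thus ?thesis by (simp add: power_one_over field_simps)
    qed
    finally show ?thesis .
  qed
  have "summable (\<lambda>n. C * (1/2::real) ^ n)" by (intro summable_mult summable_geometric) simp
  hence "summable (\<lambda>n. prob (U n))"
    by (rule summable_comparison_test'[of _ 0]) (simp add: U_prob)
  hence "AE \<omega> in M. eventually (\<lambda>n. \<omega> \<in> space M - U n) sequentially"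
    using U_ev by (intro borel_cantelli_AE1) (auto simp: emeasure_eq_measure)
  thus ?thesis
    using AE_path
  proof eventually_elim
    case (elim \<omega>)
    from elim(1) show ?case
    proof eventually_elim
      case (elim n)
      thus ?case using A(3)[of \<omega> n] \<open>B \<omega> 0 = 0 \<and> continuous_on {0..} (B \<omega>)\<close>
        by (auto simp: U_def)
    qed
  qed
qed

end

section \<open>Moment bounds\<close>

lemma sum_powr_neg_le:
  fixes s :: real
  assumes s: "0 \<le> s" "s < 1"
  shows "(\<Sum>i=1..m. real i powr (-s)) \<le> real m powr (1 - s) / (1 - s)"
proof (induction m)
  case 0
  thus ?case using s by simp
next
  case (Suc m)
  \<comment> \<open>Comparison with the integral of \<open>x powr (-s)\<close> from m to m + 1,
    through the mean value theorem. The case m = 0 is separate because \<open>x powr (1 - s)\<close>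
    need not be differentiable at 0.\<close>
  have "real (Suc m) powr (-s) \<le> (real (Suc m) powr (1 - s) - real m powr (1 - s)) / (1 - s)"
  proof (cases "m = 0")
    case True
    thus ?thesis using s by (simp add: field_simps)
  next
    case False
    hence "\<exists>z. real m < z \<and> z < real (Suc m) \<and> real (Suc m) powr (1 - s) - real m powr (1 - s) =
        (real (Suc m) - real m) * ((1 - s) * z powr (1 - s - 1))"
      by (intro MVT2) (auto intro!: derivative_eq_intros)
    then obtain z where z: "real m < z" "z < real (Suc m)"
      "real (Suc m) powr (1 - s) - real m powr (1 - s) = (1 - s) * z powr (-s)"
      by auto
    have "real (Suc m) powr (-s) \<le> z powr (-s)"
      using z False s by (intro powr_mono2') auto
    thus ?thesis using z(3) s by simp
  qed
  with Suc show ?case by (simp add: diff_divide_distrib)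
qed

lemma sum_square_symmetric:
  fixes g :: "nat \<Rightarrow> nat \<Rightarrow> real"
  assumes S: "finite S" and sym: "\<And>j k. g j k = g k j"
  shows "(\<Sum>j\<in>S. \<Sum>k\<in>S. g j k) = (\<Sum>j\<in>S. g j j) + 2 * (\<Sum>j\<in>S. \<Sum>k | k \<in> S \<and> j < k. g j k)"
proof -
  have "(\<Sum>k\<in>S. g j k) = g j j + (\<Sum>k | k \<in> S \<and> j < k. g j k) + (\<Sum>k | k \<in> S \<and> k < j. g j k)"
    if "j \<in> S" for j
  proof -
    have "S = insert j ({k\<in>S. j < k} \<union> {k\<in>S. k < j})" using that by auto
    hence "(\<Sum>k\<in>S. g j k) = (\<Sum>k\<in>insert j ({k\<in>S. j < k} \<union> {k\<in>S. k < j}). g j k)" by simp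
    also have "\<dots> = g j j + ((\<Sum>k | k \<in> S \<and> j < k. g j k) + (\<Sum>k | k \<in> S \<and> k < j. g j k))"
      using S by (subst sum.insert, simp, simp, subst sum.union_disjoint) auto
    finally show ?thesis by simp
  qed
  hence "(\<Sum>j\<in>S. \<Sum>k\<in>S. g j k) = (\<Sum>j\<in>S. g j j) + (\<Sum>j\<in>S. \<Sum>k | k \<in> S \<and> j < k. g j k)
      + (\<Sum>j\<in>S. \<Sum>k | k \<in> S \<and> k < j. g j k)"
    by (simp add: sum.distrib)
  also have "(\<Sum>j\<in>S. \<Sum>k | k \<in> S \<and> k < j. g j k) = (\<Sum>k\<in>S. \<Sum>j | j \<in> S \<and> k < j. g j k)"
    using S by (rule sum.swap_restrict) fact
  also have "\<dots> = (\<Sum>j\<in>S. \<Sum>k | k \<in> S \<and> j < k. g j k)"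
    by (simp add: sym)
  finally show ?thesis by simp
qed

text \<open>The summand is dominated by twice an increment of \<open>k \<mapsto> sqrt (1 - j / k)\<close>.\<close>

lemma sum_correlation_le:
  fixes j K :: nat
  assumes j: "1 \<le> j"
  shows "(\<Sum>k | k \<in> {1..K} \<and> j < k. 1 / sqrt k * (1 / sqrt (real k - real j) - 1 / sqrt k)) \<le> 2"
proof -
  define h where "h k = sqrt (1 - real j / real k)" for k :: nat
  have step: "1 / sqrt k * (1 / sqrt (real k - real j) - 1 / sqrt k) \<le> 2 * (h k - h (k - 1))"
    if k: "j < k" for k
  proof -
    define x y where "x = sqrt k" and "y = sqrt (real k - real j)"
    have xy: "0 < y" "y \<le> x" "x ^ 2 = k" "y ^ 2 = real k - real j" "0 < x"
      using k by (auto simp: x_def y_def)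
    define a b where "a = h k" and "b = h (k - 1)"
    have b2: "b ^ 2 = 1 - real j / (real k - 1)"
      unfolding b_def h_def using k j by (subst real_sqrt_pow2) (auto simp: of_nat_diff field_simps)
    have a: "a = y / x"
      using k by (simp add: a_def h_def x_def y_def diff_divide_distrib flip: real_sqrt_divide)
    have ra: "a ^ 2 = 1 - real j / k"
      using k xy by (simp add: a power_divide diff_divide_distrib)
    have "real j / k ^ 2 \<le> real j / (real k - 1) - real j / k"
      using k j by (simp add: field_simps power2_eq_square)
    hence "real j / k ^ 2 \<le> a ^ 2 - b ^ 2" by (simp add: ra b2)
    \<comment> \<open>This is \<open>(a - b) ^ 2 \<ge> 0\<close>. Factoring out a rather than b
      matters, as b vanishes for k = j + 1.\<close>
    also have "\<dots> \<le> 2 * (a - b) * a"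
      using sum_squares_bound[of a b] by (simp add: algebra_simps power2_eq_square)
    finally have 1: "(x ^ 2 - y ^ 2) / x ^ 4 \<le> 2 * (a - b) * a"
      using xy power_mult[of x 2 2] by simp
    have "(x - y) * x \<le> (x - y) * (x + y)"
      using xy by (intro mult_left_mono) auto
    also have "\<dots> = x ^ 2 - y ^ 2" by (simp add: algebra_simps power2_eq_square)
    finally have "(x - y) * x / x ^ 4 \<le> (x ^ 2 - y ^ 2) / x ^ 4"
      by (intro divide_right_mono) auto
    with 1 have "(x - y) * x / x ^ 4 \<le> 2 * (a - b) * a" by linarith
    moreover have "0 < a" using xy by (simp add: a)
    ultimately have "(x - y) * x / x ^ 4 / a \<le> 2 * (a - b)"
      using pos_divide_le_eq by blast
    moreover have "(x - y) * x / x ^ 4 / a = 1 / x * (1 / y - 1 / x)"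
      using xy(1,5) by (simp add: a field_simps power4_eq_xxxx)
    ultimately show ?thesis by (simp add: x_def y_def a_def b_def)
  qed
  have "(\<Sum>k | k \<in> {1..K} \<and> j < k. 1 / sqrt k * (1 / sqrt (real k - real j) - 1 / sqrt k))
      \<le> (\<Sum>k | k \<in> {1..K} \<and> j < k. 2 * (h k - h (k - 1)))"
    by (intro sum_mono step) auto
  also have "\<dots> = (\<Sum>k\<in>{j<..K}. 2 * (h k - h (k - 1)))" using j by (intro sum.cong) auto
  also have "(\<Sum>k\<in>{j<..K}. 2 * (h k - h (k - 1))) \<le> 2"
  proof (cases "j \<le> K")
    case True
    have "(\<Sum>k\<in>{j<..K}. h k - h (k - 1)) = h K - h j"
      unfolding atLeastSucAtMost_greaterThanAtMost[symmetric] by (rule sum_telescope'') fact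
    moreover have "h K \<le> 1" using j by (simp add: h_def)
    moreover have "h j = 0" using j by (simp add: h_def)
    ultimately show ?thesis by (simp only: sum_distrib_left[symmetric]) simp
  qed simp
  finally show ?thesis .
qed

section \<open>Hits and energies of the path at integer times\<close>

context brownian begin

definition near :: "real \<Rightarrow> real \<Rightarrow> 'a set" where
  "near t a = {\<omega>\<in>space M. \<bar>B \<omega> t\<bar> \<le> a}"

lemma near_events [simp]: "0 \<le> t \<Longrightarrow> near t a \<in> events"
proof -
  assume "0 \<le> t"
  hence [measurable]: "(\<lambda>\<omega>. B \<omega> t) \<in> borel_measurable M" by simp
  show ?thesis unfolding near_def by measurable
qed

lemma prob_near: "0 < t \<Longrightarrow> prob (near t a) = gauss_ball (a / sqrt t)"
  unfolding near_def by (rule prob_abs_le)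

lemma prob_near_le: "0 < t \<Longrightarrow> 0 \<le> a \<Longrightarrow> prob (near t a) \<le> a / sqrt t"
  by (simp add: prob_near gauss_ball_le)

lemma prob_near_near_le:
  "0 < s \<Longrightarrow> s < t \<Longrightarrow> 0 \<le> b \<Longrightarrow>
    prob (near s a \<inter> near t b) \<le> gauss_ball (a / sqrt s) * gauss_ball (b / sqrt (t - s))"
  using prob_two_times_le[of s t b a] by (simp add: near_def Int_def conj_ac cong: conj_cong)

lemma weighted_indicators:
  assumes "finite K" "\<And>k. k \<in> K \<Longrightarrow> A k \<in> events"
  shows "integrable M (\<lambda>\<omega>. \<Sum>k\<in>K. w k * indicator (A k) \<omega> :: real)"
    and "expectation (\<lambda>\<omega>. \<Sum>k\<in>K. w k * indicator (A k) \<omega>) = (\<Sum>k\<in>K. w k * prob (A k))"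
proof -
  have i: "integrable M (\<lambda>\<omega>. w k * indicator (A k) \<omega> :: real)" if "k \<in> K" for k
    using assms(2)[OF that] by (simp add: less_top[symmetric])
  thus "integrable M (\<lambda>\<omega>. \<Sum>k\<in>K. w k * indicator (A k) \<omega> :: real)"
    by (rule Bochner_Integration.integrable_sum)
  have "expectation (\<lambda>\<omega>. \<Sum>k\<in>K. w k * indicator (A k) \<omega>) =
      (\<Sum>k\<in>K. expectation (\<lambda>\<omega>. w k * indicator (A k) \<omega>))"
    using i by (rule Bochner_Integration.integral_sum)
  also have "\<dots> = (\<Sum>k\<in>K. w k * prob (A k))"
    using assms by (intro sum.cong) auto
  finally show "expectation (\<lambda>\<omega>. \<Sum>k\<in>K. w k * indicator (A k) \<omega>) = (\<Sum>k\<in>K. w k * prob (A k))" .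
qed

lemma weighted_indicators_sq:
  fixes w :: "nat \<Rightarrow> real"
  assumes K: "finite K" "\<And>k. k \<in> K \<Longrightarrow> A k \<in> events"
  defines "X \<equiv> \<lambda>\<omega>. (\<Sum>k\<in>K. w k * (indicator (A k) \<omega> - prob (A k)))"
  shows "integrable M (\<lambda>\<omega>. (X \<omega>)\<^sup>2)"
    and "expectation (\<lambda>\<omega>. (X \<omega>)\<^sup>2) =
      (\<Sum>j\<in>K. \<Sum>k\<in>K. w j * w k * (prob (A j \<inter> A k) - prob (A j) * prob (A k)))"
proof -
  define f where "f j k \<omega> = w j * w k * (indicator (A j \<inter> A k) \<omega> - prob (A k) * indicator (A j) \<omega>
      - prob (A j) * indicator (A k) \<omega> + prob (A j) * prob (A k))" for j k \<omega>
  have X: "(X \<omega>)\<^sup>2 = (\<Sum>j\<in>K. \<Sum>k\<in>K. f j k \<omega>)" for \<omega>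
    unfolding X_def power2_eq_square sum_product f_def
    by (intro sum.cong refl) (auto simp: indicator_inter_arith algebra_simps)
  have i: "integrable M (f j k)" if "j \<in> K" "k \<in> K" for j k
    using that K unfolding f_def by (auto simp: less_top[symmetric])
  have e: "expectation (f j k) = w j * w k * (prob (A j \<inter> A k) - prob (A j) * prob (A k))"
    if "j \<in> K" "k \<in> K" for j k
    using that K unfolding f_def by (auto simp: less_top[symmetric] prob_space)
  show "integrable M (\<lambda>\<omega>. (X \<omega>)\<^sup>2)"
    unfolding X using i by auto
  show "expectation (\<lambda>\<omega>. (X \<omega>)\<^sup>2) =
      (\<Sum>j\<in>K. \<Sum>k\<in>K. w j * w k * (prob (A j \<inter> A k) - prob (A j) * prob (A k)))"
    unfolding X using i e by (simp add: Bochner_Integration.integral_sum)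
qed


text \<open>If the path enters the region during a grid interval, then at its left end it is within
  a, the width of the region plus the oscillation. This has probability at most
  \<open>a / sqrt (j * 2 ^ m)\<close>, and the sum over j gives the mean bound c. The last factor
  \<open>2 powr (\<epsilon> * n)\<close> is the price of Markov's inequality with summable
  probabilities.\<close>

lemma AE_few_hits:
  fixes q \<epsilon> :: real and m :: "nat \<Rightarrow> nat"
  assumes q: "0 \<le> q" and eps: "0 < \<epsilon>" and m: "\<And>n. m n \<le> n"
  shows "AE \<omega> in M. eventually (\<lambda>n.
     real (card {j\<in>{1..<2 ^ (n - m n)}. \<exists>t\<in>{real j * 2 ^ m n..real j * 2 ^ m n + 2 ^ m n}. \<bar>B \<omega> t\<bar> \<le> t powr q})
      \<le> 2 * (2 powr (q * n) + 4 * 2 powr (\<epsilon> * n) * sqrt (2 ^ m n)) * sqrt (2 ^ (n - m n) / 2 ^ m n)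
        * 2 powr (\<epsilon> * n)) sequentially"
proof -
  define a where "a n = 2 powr (q * n) + 4 * 2 powr (\<epsilon> * n) * sqrt (2 ^ m n)" for n :: nat
  define c where "c n = 2 * a n * sqrt (2 ^ (n - m n) / 2 ^ m n)" for n :: nat
  have a: "0 < a n" for n by (simp add: a_def add_pos_nonneg)
  have c: "0 < c n" for n using a by (simp add: c_def)
  define X where "X n \<omega> = (\<Sum>j=1..<2 ^ (n - m n). 1 * indicator (near (real j * 2 ^ m n) (a n)) \<omega> :: real)"
    for n \<omega>
  define Z where "Z n \<omega> = X n \<omega> / (c n * 2 powr (\<epsilon> * n))" for n \<omega>
  have X_int: "integrable M (X n)" for n
    unfolding X_def by (intro weighted_indicators) auto
  have X_exp: "expectation (X n) \<le> c n" for n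
  proof -
    have "expectation (X n) = (\<Sum>j=1..<2 ^ (n - m n). 1 * prob (near (real j * 2 ^ m n) (a n)))"
      unfolding X_def by (intro weighted_indicators) auto
    also have "\<dots> \<le> (\<Sum>j=1..<2 ^ (n - m n). a n / sqrt (2 ^ m n) * real j powr (-(1/2)))"
    proof (intro sum_mono)
      fix j :: nat assume j: "j \<in> {1..<2 ^ (n - m n)}"
      have "prob (near (real j * 2 ^ m n) (a n)) \<le> a n / sqrt (real j * 2 ^ m n)"
        using j a[of n] by (intro prob_near_le) auto
      also have "\<dots> = a n / sqrt (2 ^ m n) * real j powr (-(1/2))"
        using j by (simp add: real_sqrt_mult powr_minus_divide powr_half_sqrt)
      finally show "1 * prob (near (real j * 2 ^ m n) (a n)) \<le> a n / sqrt (2 ^ m n) * real j powr (-(1/2))"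
        by simp
    qed
    also have "\<dots> \<le> (\<Sum>j=1..2 ^ (n - m n). a n / sqrt (2 ^ m n) * real j powr (-(1/2)))"
      using a[of n] by (intro sum_mono2) auto
    also have "\<dots> = a n / sqrt (2 ^ m n) * (\<Sum>j=1..2 ^ (n - m n). real j powr (-(1/2)))"
      by (simp add: sum_distrib_left)
    also have "\<dots> \<le> a n / sqrt (2 ^ m n) * (real (2 ^ (n - m n)) powr (1 - 1/2) / (1 - 1/2))"
      using a[of n] by (intro mult_left_mono sum_powr_neg_le) auto
    also have "\<dots> = c n"
      by (simp add: c_def powr_half_sqrt real_sqrt_divide)
    finally show ?thesis .
  qed
  have "AE \<omega> in M. eventually (\<lambda>n. Z n \<omega> < 1) sequentially"
  proof (rule AE_eventually_less_one)
    show "integrable M (Z n)" for n unfolding Z_def using X_int by simp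
    show "0 \<le> Z n \<omega>" for n \<omega>
      unfolding Z_def X_def using c[of n] by (intro divide_nonneg_nonneg sum_nonneg) auto
    have "expectation (Z n) \<le> (2 powr (-\<epsilon>)) ^ n" for n
    proof -
      have "expectation (Z n) = expectation (X n) / (c n * 2 powr (\<epsilon> * n))"
        unfolding Z_def by simp
      also have "\<dots> \<le> c n / (c n * 2 powr (\<epsilon> * n))"
        using X_exp[of n] c[of n] by (intro divide_right_mono) auto
      also have "\<dots> = 2 powr (-\<epsilon> * n)" using c[of n] by (simp add: powr_minus_divide)
      finally show ?thesis by (simp add: powr_powr flip: powr_realpow)
    qed
    thus "eventually (\<lambda>n. expectation (Z n) \<le> (2 powr (-\<epsilon>)) ^ n) sequentially" by simp
    have "2 powr (-\<epsilon>) < 2 powr 0" using eps by (intro powr_less_mono) auto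
    thus "summable (\<lambda>n. (2 powr (-\<epsilon>)) ^ n)" by (intro summable_geometric) simp
  qed
  moreover have "AE \<omega> in M. eventually (\<lambda>n. \<forall>j<2 ^ n. \<forall>t\<in>{real j * 2 ^ m n..real j * 2 ^ m n + 2 ^ m n}.
     \<bar>B \<omega> t - B \<omega> (real j * 2 ^ m n)\<bar> \<le> 4 * 2 powr (\<epsilon> * n) * sqrt (2 ^ m n)) sequentially"
    by (rule AE_oscillation) (use eps in auto)
  ultimately show ?thesis
    using AE_space
  proof eventually_elim
    case (elim \<omega>)
    from elim(1,2) show ?case
    proof eventually_elim
      case (elim n)
      let ?J = "{j\<in>{1..<2 ^ (n - m n)}. \<exists>t\<in>{real j * 2 ^ m n..real j * 2 ^ m n + 2 ^ m n}. \<bar>B \<omega> t\<bar> \<le> t powr q}"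
      have "1 \<le> indicator (near (real j * 2 ^ m n) (a n)) \<omega> * (1::real)" if "j \<in> ?J" for j
      proof -
        from that obtain t where j: "1 \<le> j" "j < 2 ^ (n - m n)"
          and t: "t \<in> {real j * 2 ^ m n..real j * 2 ^ m n + 2 ^ m n}" "\<bar>B \<omega> t\<bar> \<le> t powr q" by auto
        have "j < 2 ^ n" using j(2) by (rule less_le_trans) (simp add: power_increasing)
        hence "\<bar>B \<omega> t - B \<omega> (real j * 2 ^ m n)\<bar> \<le> 4 * 2 powr (\<epsilon> * n) * sqrt (2 ^ m n)"
          using elim(2) t(1) by blast
        moreover have "t powr q \<le> 2 powr (q * n)"
        proof -
          have "real (Suc j) \<le> real (2 ^ (n - m n))" using j(2) by (simp only: of_nat_le_iff Suc_leI)
          hence "real (Suc j) * 2 ^ m n \<le> 2 ^ (n - m n) * 2 ^ m n" by (intro mult_right_mono) auto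
          also have "\<dots> = (2::real) ^ n" using m[of n] by (simp flip: power_add)
          finally have "t \<le> 2 ^ n" using t(1) by (simp add: algebra_simps)
          moreover have "0 \<le> t" using t(1) by (auto intro: order_trans[rotated])
          ultimately have "t powr q \<le> (2 ^ n) powr q" using q by (intro powr_mono2) auto
          thus ?thesis by (simp add: powr_powr mult.commute flip: powr_realpow)
        qed
        ultimately have "\<bar>B \<omega> (real j * 2 ^ m n)\<bar> \<le> a n" using t(2) unfolding a_def by linarith
        thus ?thesis using \<open>\<omega> \<in> space M\<close> by (simp add: near_def)
      qed
      hence "real (card ?J) \<le> (\<Sum>j\<in>?J. indicator (near (real j * 2 ^ m n) (a n)) \<omega> * 1)"
        using sum_mono[of ?J "\<lambda>_. 1::real"] by simp
      also have "\<dots> \<le> X n \<omega>"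
        unfolding X_def by (subst mult.commute, intro sum_mono2) auto
      also have "\<dots> \<le> c n * 2 powr (\<epsilon> * n)"
        using elim(1) c[of n] by (simp add: Z_def divide_less_eq)
      finally show ?case by (simp add: c_def a_def)
    qed
  qed
qed

text \<open>Chebyshev's inequality: the weighted mean is at least H / 6 and the variance at most 2
  H, with H a harmonic sum of size at least \<open>i ^ 4 / 2\<close>. A deviation below H / 12
  leaves H / 12, hence the 24.\<close>

lemma AE_many_hits:
  fixes \<gamma> :: real
  assumes \<gamma>: "0 \<le> \<gamma>" "\<gamma> \<le> 1/2"
  shows "AE \<omega> in M. eventually (\<lambda>i::nat.
     real (i ^ 4) / 24 \<le> (\<Sum>k | k \<in> {1..<2 ^ (i ^ 4)} \<and> \<bar>B \<omega> (real k)\<bar> \<le> real k powr \<gamma> / 2.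
        real k powr (-(1/2) - \<gamma>))) sequentially"
proof -
  define A where "A k = near (real k) (real k powr \<gamma> / 2)" for k
  define w where "w k = real k powr (-(1/2) - \<gamma>)" for k
  define K where "K i = (2::nat) ^ (i ^ 4) - 1" for i :: nat
  define X where "X i \<omega> = (\<Sum>k=1..K i. w k * (indicator (A k) \<omega> - prob (A k)))" for i \<omega>
  define H where "H i = (\<Sum>k=1..K i. 1 / real k)" for i
  have A: "A k \<in> events" for k by (simp add: A_def)
  have w: "0 \<le> w k" for k by (simp add: w_def)
  have wa: "w k * real k powr \<gamma> = 1 / sqrt k" if "1 \<le> k" for k
    using that by (simp add: w_def powr_minus_divide powr_half_sqrt flip: powr_add)
  have H_ge: "real (i ^ 4) / 2 \<le> H i" for i
  proof -
    have "real (K i) + 1 = 2 ^ (i ^ 4)"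
      by (simp add: K_def of_nat_diff)
    hence "ln (2 ^ (i ^ 4)) \<le> H i"
      using ln_le_harm[of "K i"] by (simp add: H_def harm_def inverse_eq_divide)
    moreover have "ln (2 ^ (i ^ 4)) = real (i ^ 4) * ln 2" by (simp add: ln_realpow)
    moreover have "real (i ^ 4) * (1/2) \<le> real (i ^ 4) * ln 2"
      using ln2_ge_two_thirds by (intro mult_left_mono) auto
    ultimately show ?thesis by simp
  qed
  \<comment> \<open>The probability is at least a third of
    \<open>k powr \<gamma> / (2 * sqrt k)\<close>, where \<open>\<gamma> \<le> 1/2\<close> keeps the
    argument of \<open>gauss_ball\<close> below 1; the weight turns this into 1 / (6 k).\<close>
  have mean: "H i / 6 \<le> (\<Sum>k=1..K i. w k * prob (A k))" for i
    unfolding H_def sum_divide_distrib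
  proof (intro sum_mono)
    fix k assume k: "k \<in> {1..K i}"
    let ?u = "real k powr \<gamma> / 2 / sqrt k"
    have "real k powr \<gamma> \<le> real k powr (1/2)" using k \<gamma> by (intro powr_mono) auto
    moreover have "0 \<le> sqrt k" by simp
    ultimately have "real k powr \<gamma> / 2 \<le> sqrt k" unfolding powr_half_sqrt[OF of_nat_0_le_iff] by linarith
    hence "?u \<le> 1" using k by (subst divide_le_eq_1_pos) auto
    hence "?u / 3 \<le> gauss_ball ?u" by (intro gauss_ball_ge) auto
    also have "\<dots> = prob (A k)" using k unfolding A_def by (intro prob_near[symmetric]) auto
    finally have "?u / 3 \<le> prob (A k)" .
    hence "w k * (?u / 3) \<le> w k * prob (A k)" by (intro mult_left_mono w)
    also have "w k * (?u / 3) = (w k * real k powr \<gamma>) / sqrt k / 6" by simp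
    also have "\<dots> = 1 / k / 6" using k by (simp add: wa)
    finally show "1 / real k / 6 \<le> w k * prob (A k)" .
  qed
  have var: "expectation (\<lambda>\<omega>. (X i \<omega>)\<^sup>2) \<le> 2 * H i" for i
  proof -
    define g where "g j k = w j * w k * (prob (A j \<inter> A k) - prob (A j) * prob (A k))" for j k
    have diag: "g k k \<le> 1 / k" if "k \<in> {1..K i}" for k
    proof -
      have "g k k \<le> w k * w k * prob (A k)"
        unfolding g_def by (intro mult_left_mono) (auto simp: w)
      also have "\<dots> \<le> w k * w k * (real k powr \<gamma> / 2 / sqrt k)"
        using that w unfolding A_def by (intro mult_left_mono prob_near_le) auto
      also have "\<dots> = w k * (w k * real k powr \<gamma>) / (2 * sqrt k)" by simp
      also have "\<dots> = w k / (2 * k)" using that by (simp add: wa)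
      also have "\<dots> \<le> 1 / k"
      proof -
        have "w k \<le> real k powr 0" unfolding w_def using that \<gamma> by (intro powr_mono) auto
        thus ?thesis using that by (simp add: field_simps)
      qed
      finally show ?thesis .
    qed
    \<comment> \<open>The joint bound and the product of the exact one-time probabilities share the
      factor of j. What remains is a difference of \<open>gauss_ball\<close> for the time spans k -
      j and k, which is small when k is much larger than j.\<close>
    have off: "g j k \<le> 1/4 * (1 / j) * (1 / sqrt k * (1 / sqrt (real k - real j) - 1 / sqrt k))"
      if "1 \<le> j" "j < k" for j k
    proof -
      let ?u = "real j powr \<gamma> / 2 / sqrt j" and ?b = "real k powr \<gamma> / 2"
      let ?v = "?b / sqrt (real k - real j)" and ?v' = "?b / sqrt k"
      have v: "?v' \<le> ?v" using that by (intro divide_left_mono) auto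
      have "prob (A j \<inter> A k) - prob (A j) * prob (A k) \<le> gauss_ball ?u * gauss_ball ?v - gauss_ball ?u * gauss_ball ?v'"
        using prob_near_near_le[of j k ?b "real j powr \<gamma> / 2"] that by (simp add: A_def prob_near)
      also have "\<dots> = gauss_ball ?u * (gauss_ball ?v - gauss_ball ?v')" by (simp add: algebra_simps)
      also have "\<dots> \<le> ?u * (?v - ?v')"
        using that v by (intro mult_mono' gauss_ball_le gauss_ball_diff_le)
          (auto simp: gauss_ball_nonneg gauss_ball_mono)
      finally have "g j k \<le> w j * w k * (?u * (?v - ?v'))"
        unfolding g_def by (intro mult_left_mono mult_nonneg_nonneg w)
      also have "\<dots> = 1/4 * (w j * real j powr \<gamma>) / sqrt j *
          ((w k * real k powr \<gamma>) * (1 / sqrt (real k - real j) - 1 / sqrt k))"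
        by (simp add: algebra_simps)
      also have "\<dots> = 1/4 * (1 / j) * (1 / sqrt k * (1 / sqrt (real k - real j) - 1 / sqrt k))"
        using that by (simp add: wa)
      finally show ?thesis .
    qed
    have "expectation (\<lambda>\<omega>. (X i \<omega>)\<^sup>2) = (\<Sum>j=1..K i. \<Sum>k=1..K i. g j k)"
      unfolding X_def g_def using A by (intro weighted_indicators_sq) auto
    also have "\<dots> = (\<Sum>j=1..K i. g j j) + 2 * (\<Sum>j=1..K i. \<Sum>k | k \<in> {1..K i} \<and> j < k. g j k)"
      by (intro sum_square_symmetric) (auto simp: g_def Int_commute)
    also have "(\<Sum>j=1..K i. g j j) \<le> H i" unfolding H_def by (intro sum_mono diag)
    also have "(\<Sum>j=1..K i. \<Sum>k | k \<in> {1..K i} \<and> j < k. g j k) \<le> (\<Sum>j=1..K i. 1/4 * (1 / j) * 2)"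
    proof (rule sum_mono)
      fix j assume j: "j \<in> {1..K i}"
      have "(\<Sum>k | k \<in> {1..K i} \<and> j < k. g j k) \<le> (\<Sum>k | k \<in> {1..K i} \<and> j < k.
          1/4 * (1 / j) * (1 / sqrt k * (1 / sqrt (real k - real j) - 1 / sqrt k)))"
        using j by (intro sum_mono off) auto
      also have "\<dots> \<le> 1/4 * (1 / j) * 2"
        unfolding sum_distrib_left[symmetric] using j by (intro mult_left_mono sum_correlation_le) auto
      finally show "(\<Sum>k | k \<in> {1..K i} \<and> j < k. g j k) \<le> 1/4 * (1 / j) * 2" .
    qed
    also have "\<dots> = H i / 2" by (simp add: H_def sum_divide_distrib mult.commute)
    finally show ?thesis by simp
  qed
  \<comment> \<open>With the allowed deviation H / 12 the mean of Z is at most 288 / H. Although H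
    grows like \<open>i ^ 4\<close>, the weaker order \<open>i ^ 2\<close> already makes this
    summable.\<close>
  define Z where "Z i \<omega> = (X i \<omega>)\<^sup>2 / (H i / 12)\<^sup>2" for i \<omega>
  have "AE \<omega> in M. eventually (\<lambda>i. Z i \<omega> < 1) sequentially"
  proof (rule AE_eventually_less_one)
    show "integrable M (Z i)" for i
      unfolding Z_def X_def using A by (intro integrable_divide weighted_indicators_sq) auto
    show "0 \<le> Z i \<omega>" for i \<omega> by (simp add: Z_def)
    have "expectation (Z i) \<le> 576 * (1 / real i ^ 2)" if "1 \<le> i" for i
    proof -
      have i4: "real i ^ 2 \<le> real (i ^ 4)" using that by (simp add: power_increasing)
      hence H: "real i ^ 2 / 2 \<le> H i" "0 < real i ^ 2 / 2" using H_ge[of i] that by auto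
      hence Hp: "0 < H i" by linarith
      have "expectation (Z i) = expectation (\<lambda>\<omega>. (X i \<omega>)\<^sup>2) / (H i / 12)\<^sup>2"
        unfolding Z_def by simp
      also have "\<dots> \<le> 2 * H i / (H i / 12)\<^sup>2" by (intro divide_right_mono var) simp
      also have "\<dots> = 288 / H i" using Hp by (simp add: power2_eq_square)
      also have "\<dots> \<le> 288 / (real i ^ 2 / 2)"
        using H Hp that by (intro divide_left_mono mult_pos_pos) auto
      finally show ?thesis by simp
    qed
    thus "eventually (\<lambda>i. expectation (Z i) \<le> 576 * (1 / real i ^ 2)) sequentially"
      by (intro eventually_sequentiallyI)
    show "summable (\<lambda>i. 576 * (1 / real i ^ 2))"
      using inverse_power_summable[of 2, where 'a=real]
      by (intro summable_mult) (simp add: inverse_eq_divide)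
  qed
  thus ?thesis
    using AE_space
  proof eventually_elim
    case (elim \<omega>)
    from elim(1) eventually_ge_at_top[of "1::nat"] show ?case
    proof eventually_elim
      case (elim i)
      have "0 < real (i ^ 4)" using elim by simp
      hence Hp: "0 < H i" using H_ge[of i] by linarith
      hence "\<bar>X i \<omega>\<bar>\<^sup>2 < (H i / 12)\<^sup>2"
        using elim(1) by (simp add: Z_def)
      hence "\<bar>X i \<omega>\<bar> < H i / 12"
        using Hp by (intro power2_less_imp_less[of "\<bar>X i \<omega>\<bar>" "H i / 12"]) simp_all
      moreover have "X i \<omega> = (\<Sum>k=1..K i. w k * indicator (A k) \<omega>) - (\<Sum>k=1..K i. w k * prob (A k))"
        by (simp add: X_def algebra_simps sum_subtractf)
      ultimately have "real (i ^ 4) / 24 \<le> (\<Sum>k=1..K i. w k * indicator (A k) \<omega>)"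
        using mean[of i] H_ge[of i] by linarith
      also have "\<dots> = (\<Sum>k | k \<in> {1..K i} \<and> \<omega> \<in> A k. w k)"
        unfolding sum.inter_filter[OF finite_atLeastAtMost]
        by (intro sum.cong refl) (simp add: indicator_def)
      also have "{k. k \<in> {1..K i} \<and> \<omega> \<in> A k} =
          {k. k \<in> {1..<2 ^ (i ^ 4)} \<and> \<bar>B \<omega> (real k)\<bar> \<le> real k powr \<gamma> / 2}"
      proof -
        have "k \<le> K i \<longleftrightarrow> k < 2 ^ (i ^ 4)" for k
        proof -
          have "(0::nat) < 2 ^ (i ^ 4)" by simp
          thus ?thesis unfolding K_def by linarith
        qed
        thus ?thesis using \<open>\<omega> \<in> space M\<close> by (auto simp: A_def near_def)
      qed
      finally show ?case by (simp add: w_def)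
    qed
  qed
qed


text \<open>Two times j < k of shell n are both hits with probability at most
  \<open>2 powr (-n / 2)\<close> times half of \<open>(k - j) powr (-1/2)\<close>. With the kernel,
  the sum over k has exponent \<open>\<rho> + 1/2 < 1\<close> and is of order
  \<open>2 powr ((1/2 - \<rho>) * n)\<close>; the sum over the \<open>2 ^ n\<close> values of j then
  yields \<open>2 powr ((1 - \<rho>) * n)\<close>. After normalisation the \<open>i ^ 4\<close>
  shells have total mean O(i^4), and the threshold \<open>i ^ 6\<close> makes the Markov bounds
  summable.\<close>

lemma AE_energy:
  fixes \<rho> :: real
  assumes \<rho>: "0 \<le> \<rho>" "\<rho> < 1/2"
  defines "P \<equiv> \<lambda>\<omega> n. {k::nat. k \<in> {2 ^ n..<2 ^ Suc n} \<and> \<bar>B \<omega> (real k)\<bar> \<le> 1/2}"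
  shows "AE \<omega> in M. eventually (\<lambda>i::nat.
     (\<Sum>n<i ^ 4. 2 powr (-(1 - \<rho>) * n) * (\<Sum>j\<in>P \<omega> n. \<Sum>k\<in>P \<omega> n. (1 + \<bar>real j - real k\<bar>) powr (-\<rho>)))
     \<le> real i ^ 6) sequentially"
proof -
  define A where "A k = near (real k) (1/2)" for k
  define v where "v j k = (1 + \<bar>real j - real k\<bar>) powr (-\<rho>)" for j k
  define I where "I n \<omega> = (\<Sum>j\<in>{2 ^ n..<2 ^ Suc n}. \<Sum>k\<in>{2 ^ n..<2 ^ Suc n}. v j k * indicator (A j \<inter> A k) \<omega> :: real)"
    for n \<omega>
  \<comment> \<open>The 1 pays for the diagonal, the other term for the pairs with j < k, counted
    twice.\<close>
  define C where "C = 1 + 2 * (1/2 / (1/2 - \<rho>))"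
  have C: "0 < C" unfolding C_def using \<rho> by (intro add_pos_pos) auto
  have A: "A k \<in> events" for k by (simp add: A_def)
  have I_int: "integrable M (I n)" for n
    unfolding I_def by (intro Bochner_Integration.integrable_sum weighted_indicators) (auto simp: A)
  have diag: "v k k * prob (A k) \<le> 2 powr (-(1/2) * n)" if "k \<in> {2 ^ n..<2 ^ Suc n}" for n k
  proof -
    have k: "2 ^ n \<le> real k" "0 < real k"
    proof -
      have "2 ^ n \<le> k" using that by simp
      hence "real (2 ^ n) \<le> real k" by (simp only: of_nat_le_iff)
      thus "2 ^ n \<le> real k" by simp
      have "(0::real) < 2 ^ n" by simp
      thus "0 < real k" using \<open>2 ^ n \<le> real k\<close> by linarith
    qed
    have "v k k * prob (A k) \<le> (1/2) / sqrt k"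
      unfolding A_def v_def using prob_near_le[of k "1/2"] k by simp
    also have "\<dots> \<le> real k powr (-(1/2))"
      using k by (simp add: powr_minus_divide powr_half_sqrt field_simps)
    also have "\<dots> \<le> (2 ^ n) powr (-(1/2))" using k by (intro powr_mono2') auto
    finally show ?thesis by (simp add: powr_powr mult.commute flip: powr_realpow)
  qed
  have off: "v j k * prob (A j \<inter> A k) \<le> 1/2 * 2 powr (-(1/2) * n) * real (k - j) powr (-(\<rho> + 1/2))"
    if j: "j \<in> {2 ^ n..<2 ^ Suc n}" and jk: "j < k" for n j k
  proof -
    have "0 < j" using j by (auto intro: less_le_trans[of 0 "2 ^ n"])
    have "prob (A j \<inter> A k) \<le> gauss_ball (1/2 / sqrt j) * gauss_ball (1/2 / sqrt (real k - real j))"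
      using prob_near_near_le[of j k "1/2" "1/2"] jk \<open>0 < j\<close> by (simp add: A_def)
    also have "\<dots> \<le> prob (A j) * (1/2 / sqrt (real k - real j))"
    proof -
      have "gauss_ball (1/2 / sqrt (real k - real j)) \<le> 1/2 / sqrt (real k - real j)"
        using jk by (intro gauss_ball_le) auto
      moreover have "prob (A j) = gauss_ball (1/2 / sqrt j)"
        using \<open>0 < j\<close> unfolding A_def by (intro prob_near) auto
      ultimately show ?thesis
        by (simp only:) (intro mult_left_mono gauss_ball_nonneg)
    qed
    also have "\<dots> \<le> 2 powr (-(1/2) * n) * (1/2 / sqrt (real k - real j))"
      using diag[OF j] jk by (intro mult_right_mono) (auto simp: v_def)
    finally have "v j k * prob (A j \<inter> A k) \<le> v j k * (2 powr (-(1/2) * n) * (1/2 / sqrt (real k - real j)))"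
      by (intro mult_left_mono) (auto simp: v_def)
    also have "\<dots> \<le> real (k - j) powr (-\<rho>) * (2 powr (-(1/2) * n) * (1/2 / sqrt (real k - real j)))"
      using jk \<rho> unfolding v_def by (intro mult_right_mono powr_mono2') (auto simp: of_nat_diff)
    also have "\<dots> = 1/2 * 2 powr (-(1/2) * n) * (real (k - j) powr (-\<rho>) * real (k - j) powr (-(1/2)))"
      using jk by (simp add: powr_minus_divide powr_half_sqrt of_nat_diff)
    finally show ?thesis by (simp flip: powr_add)
  qed
  have I_exp: "expectation (I n) \<le> C * 2 powr ((1 - \<rho>) * n)" for n
  proof -
    let ?S = "{2 ^ n..<2 ^ Suc n} :: nat set"
    have "expectation (I n) = (\<Sum>j\<in>?S. \<Sum>k\<in>?S. v j k * prob (A j \<inter> A k))"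
      unfolding I_def using weighted_indicators[of ?S "\<lambda>k. A j \<inter> A k" for j] A
      by (subst Bochner_Integration.integral_sum) auto
    also have "\<dots> = (\<Sum>j\<in>?S. v j j * prob (A j)) +
        2 * (\<Sum>j\<in>?S. \<Sum>k | k \<in> ?S \<and> j < k. v j k * prob (A j \<inter> A k))"
      by (subst sum_square_symmetric) (auto simp: v_def Int_commute abs_minus_commute)
    also have "(\<Sum>j\<in>?S. v j j * prob (A j)) \<le> (\<Sum>j\<in>?S. 2 powr (-(1/2) * n))"
      by (intro sum_mono diag)
    also have "\<dots> = 2 ^ n * 2 powr (-(1/2) * n)" by simp
    also have "(\<Sum>j\<in>?S. \<Sum>k | k \<in> ?S \<and> j < k. v j k * prob (A j \<inter> A k)) \<le>
        (\<Sum>j\<in>?S. 1/2 * 2 powr (-(1/2) * n) * (2 powr ((1/2 - \<rho>) * n) / (1/2 - \<rho>)))"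
    proof (rule sum_mono)
      fix j assume j: "j \<in> ?S"
      have "(\<Sum>k | k \<in> ?S \<and> j < k. v j k * prob (A j \<inter> A k)) \<le>
          (\<Sum>k | k \<in> ?S \<and> j < k. 1/2 * 2 powr (-(1/2) * n) * real (k - j) powr (-(\<rho> + 1/2)))"
        using j by (intro sum_mono off) auto
      also have "\<dots> = 1/2 * 2 powr (-(1/2) * n) * (\<Sum>k | k \<in> ?S \<and> j < k. real (k - j) powr (-(\<rho> + 1/2)))"
        by (simp only: sum_distrib_left)
      also have "(\<Sum>k | k \<in> ?S \<and> j < k. real (k - j) powr (-(\<rho> + 1/2)))
          = (\<Sum>i\<in>(\<lambda>k. k - j) ` {k. k \<in> ?S \<and> j < k}. real i powr (-(\<rho> + 1/2)))"
        by (subst sum.reindex) (auto simp: inj_on_def)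
      also have "\<dots> \<le> (\<Sum>i=1..2 ^ n. real i powr (-(\<rho> + 1/2)))"
        using j by (intro sum_mono2) auto
      also have "\<dots> \<le> real (2 ^ n) powr (1 - (\<rho> + 1/2)) / (1 - (\<rho> + 1/2))"
        using \<rho> by (intro sum_powr_neg_le) auto
      also have "\<dots> = 2 powr ((1/2 - \<rho>) * n) / (1/2 - \<rho>)"
        by (simp add: powr_powr mult.commute flip: powr_realpow)
      finally show "(\<Sum>k | k \<in> ?S \<and> j < k. v j k * prob (A j \<inter> A k)) \<le>
          1/2 * 2 powr (-(1/2) * n) * (2 powr ((1/2 - \<rho>) * n) / (1/2 - \<rho>))"
        by (simp add: mult_left_mono)
    qed
    also have "\<dots> = 2 ^ n * 2 powr (-(1/2) * n) * (2 powr ((1/2 - \<rho>) * n) * (1/2 / (1/2 - \<rho>)))"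
      by simp
    also have "2 ^ n * 2 powr (-(1/2) * n) + 2 * \<dots> \<le>
        2 ^ n * 2 powr (-(1/2) * n) * (2 powr ((1/2 - \<rho>) * n)) * C"
    proof -
      have "1 \<le> 2 powr ((1/2 - \<rho>) * n)" using \<rho> by (intro ge_one_powr_ge_zero) auto
      hence "2 ^ n * 2 powr (-(1/2) * n) * 1 \<le> 2 ^ n * 2 powr (-(1/2) * n) * 2 powr ((1/2 - \<rho>) * n)"
        by (intro mult_left_mono) auto
      thus ?thesis unfolding C_def distrib_left by linarith
    qed
    also have "2 ^ n * 2 powr (-(1/2) * n) * (2 powr ((1/2 - \<rho>) * n)) = 2 powr ((1 - \<rho>) * n)"
      by (simp add: algebra_simps flip: powr_realpow powr_add)
    finally show ?thesis by (simp add: mult.commute)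
  qed
  define Z where "Z i \<omega> = (\<Sum>n<i ^ 4. 2 powr (-(1 - \<rho>) * n) * I n \<omega>) / real i ^ 6" for i \<omega>
  have "AE \<omega> in M. eventually (\<lambda>i. Z i \<omega> < 1) sequentially"
  proof (rule AE_eventually_less_one)
    show "integrable M (Z i)" for i
      unfolding Z_def using I_int by (intro integrable_divide) auto
    show "0 \<le> Z i \<omega>" for i \<omega>
      unfolding Z_def I_def v_def by (intro divide_nonneg_nonneg sum_nonneg mult_nonneg_nonneg) auto
    have "expectation (Z i) \<le> C * (1 / real i ^ 2)" if "1 \<le> i" for i
    proof -
      have "expectation (Z i) = (\<Sum>n<i ^ 4. 2 powr (-(1 - \<rho>) * n) * expectation (I n)) / real i ^ 6"
        unfolding Z_def using I_int by (simp add: Bochner_Integration.integral_sum)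
      also have "\<dots> \<le> (\<Sum>n<i ^ 4. 2 powr (-(1 - \<rho>) * n) * (C * 2 powr ((1 - \<rho>) * n))) / real i ^ 6"
        by (intro divide_right_mono sum_mono mult_left_mono I_exp) auto
      also have "\<dots> = (\<Sum>n<i ^ 4. C) / real i ^ 6"
      proof -
        have "2 powr (-(1 - \<rho>) * n) * (C * 2 powr ((1 - \<rho>) * n)) = C" for n :: nat
          by (subst mult.left_commute, subst powr_add[symmetric]) (simp add: algebra_simps)
        thus ?thesis by (simp only:)
      qed
      also have "\<dots> = C * (1 / real i ^ 2)"
        using that by (simp add: field_simps flip: power_add)
      finally show ?thesis .
    qed
    thus "eventually (\<lambda>i. expectation (Z i) \<le> C * (1 / real i ^ 2)) sequentially"
      by (intro eventually_sequentiallyI)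
    show "summable (\<lambda>i. C * (1 / real i ^ 2))"
      using inverse_power_summable[of 2, where 'a=real]
      by (intro summable_mult) (simp add: inverse_eq_divide)
  qed
  thus ?thesis
    using AE_space
  proof eventually_elim
    case (elim \<omega>)
    have I: "I n \<omega> = (\<Sum>j\<in>P \<omega> n. \<Sum>k\<in>P \<omega> n. v j k)" for n
    proof -
      have P: "P \<omega> n = {k\<in>{2 ^ n..<2 ^ Suc n}. \<omega> \<in> A k}" for n
        using \<open>\<omega> \<in> space M\<close> by (auto simp: P_def A_def near_def)
      show ?thesis
        unfolding P I_def sum.inter_filter[OF finite_atLeastLessThan]
      proof (intro sum.cong refl)
        fix j
        show "(\<Sum>k\<in>{2 ^ n..<2 ^ Suc n}. v j k * indicator (A j \<inter> A k) \<omega>) =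
          (if \<omega> \<in> A j then \<Sum>k\<in>{2 ^ n..<2 ^ Suc n}. if \<omega> \<in> A k then v j k else 0 else 0)"
        proof (cases "\<omega> \<in> A j")
          case True
          thus ?thesis by (simp only: if_True) (intro sum.cong refl, simp add: indicator_def)
        next
          case False
          thus ?thesis by (simp only: if_False) (intro sum.neutral ballI, simp)
        qed
      qed
    qed
    from elim(1) eventually_ge_at_top[of "1::nat"] show ?case
    proof eventually_elim
      case (elim i)
      hence "(\<Sum>n<i ^ 4. 2 powr (-(1 - \<rho>) * n) * I n \<omega>) < real i ^ 6"
        by (simp add: Z_def)
      thus ?case by (simp add: I v_def)
    qed
  qed
qed

end

section \<open>Bounds on the macroscopic contents\<close>

lemma nu_le:
  assumes "finite F" "\<And>Q. Q \<in> F \<Longrightarrow> int_interval_in n Q" "E \<inter> shell n \<subseteq> \<Union>F"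
  shows "nu n \<rho> E \<le> (\<Sum>Q\<in>F. (measure lebesgue Q / 2 ^ n) powr \<rho>)"
  unfolding nu_def using assms
  by (intro cInf_lower bdd_belowI[of _ 0]) (auto intro: sum_nonneg)

text \<open>Ensures that the infimum in \<open>nu\<close> runs over a nonempty set. For n = 0
  truncated subtraction makes \<open>shell 0\<close> the empty set \<open>{1..<1}\<close>.\<close>

lemma int_interval_in_shell: "0 < n \<Longrightarrow> int_interval_in n (shell n)"
  unfolding int_interval_in_def shell_def
  by (intro conjI exI[of _ "2 ^ (n - 1)"] exI[of _ "2 ^ n"]) (auto intro: power_strict_increasing)

lemma nu_ge:
  assumes "0 < n" "\<And>F. finite F \<Longrightarrow> (\<And>Q. Q \<in> F \<Longrightarrow> int_interval_in n Q) \<Longrightarrow> E \<inter> shell n \<subseteq> \<Union>F \<Longrightarrow>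
    x \<le> (\<Sum>Q\<in>F. (measure lebesgue Q / 2 ^ n) powr \<rho>)"
  shows "x \<le> nu n \<rho> E"
  unfolding nu_def
proof (rule cInf_greatest)
  show "{(\<Sum>Q\<in>F. (measure lebesgue Q / 2 ^ n) powr \<rho>) | F.
    finite F \<and> (\<forall>Q\<in>F. int_interval_in n Q) \<and> E \<inter> shell n \<subseteq> \<Union>F} \<noteq> {}"
    using int_interval_in_shell[OF assms(1)] by (auto intro!: exI[of _ "{shell n}"])
qed (use assms(2) in auto)

lemma nu_nonneg: "0 < n \<Longrightarrow> 0 \<le> nu n \<rho> E"
  by (rule nu_ge) (auto intro: sum_nonneg)

lemma int_interval_in_measure:
  assumes "int_interval_in n Q"
  obtains a b :: int where "a < b" "Q \<subseteq> {real_of_int a..real_of_int b}" "measure lebesgue Q = real_of_int (b - a)"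
proof -
  from assms obtain a b :: int where ab: "a < b" "{real_of_int a<..<real_of_int b} \<subseteq> Q"
    "Q \<subseteq> {real_of_int a..real_of_int b}"
    unfolding int_interval_in_def by blast
  \<comment> \<open>Between an open interval and its closure there is room for two points only, so Q
    is Borel whatever its type.\<close>
  have "Q = {real_of_int a<..<real_of_int b} \<union> (Q \<inter> {real_of_int a, real_of_int b})"
    using ab by force
  moreover have "finite (Q \<inter> {real_of_int a, real_of_int b})" by simp
  ultimately have Q: "Q \<in> sets borel"
    by (metis borel_open finite_imp_closed borel_closed open_greaterThanLessThan sets.Un)
  hence Q': "Q \<in> lmeasurable"
    using bounded_subset[OF bounded_closed_interval ab(3)] by (intro bounded_set_imp_lmeasurable) auto
  have "measure lebesgue Q \<le> measure lebesgue {real_of_int a..real_of_int b}"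
    using ab Q' by (intro measure_mono_fmeasurable) (auto simp: fmeasurableD)
  moreover have "measure lebesgue {real_of_int a<..<real_of_int b} \<le> measure lebesgue Q"
    using ab Q' by (intro measure_mono_fmeasurable) auto
  ultimately have "measure lebesgue Q = real_of_int (b - a)" using ab by simp
  thus ?thesis using ab that by blast
qed

lemma int_interval_in_ratio:
  assumes "int_interval_in n Q" "0 < n"
  shows "1 \<le> measure lebesgue Q" "measure lebesgue Q \<le> 2 ^ n"
proof -
  obtain a b :: int where ab: "a < b" "measure lebesgue Q = real_of_int (b - a)"
    using int_interval_in_measure[OF assms(1)] by metis
  thus "1 \<le> measure lebesgue Q" by simp
  have "Q \<subseteq> {2 ^ (n - 1)..2 ^ n}" using assms(1) by (auto simp: int_interval_in_def shell_def)
  \<comment> \<open>\<open>measure\<close> is 0 on non-measurable sets, so the positive length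
    excludes these.\<close>
  moreover have "Q \<in> sets lebesgue"
  proof (rule ccontr)
    assume "Q \<notin> sets lebesgue"
    thus False using ab by (simp add: measure_notin_sets)
  qed
  ultimately have "measure lebesgue Q \<le> measure lebesgue {2 ^ (n - 1)..2 ^ n :: real}"
    by (intro measure_mono_fmeasurable) auto
  also have "\<dots> \<le> 2 ^ n" by simp
  finally show "measure lebesgue Q \<le> 2 ^ n" .
qed

text \<open>The ratios are at most 1, so their powers decrease in the exponent, for each covering
  family separately.\<close>

lemma nu_antimono_exponent:
  assumes "\<rho> \<le> \<rho>'" "0 < n"
  shows "nu n \<rho>' E \<le> nu n \<rho> E"
proof (rule nu_ge)
  fix F assume F: "finite F" "\<And>Q. Q \<in> F \<Longrightarrow> int_interval_in n Q" "E \<inter> shell n \<subseteq> \<Union>F"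
  have "nu n \<rho>' E \<le> (\<Sum>Q\<in>F. (measure lebesgue Q / 2 ^ n) powr \<rho>')" by (rule nu_le) (use F in auto)
  also have "\<dots> \<le> (\<Sum>Q\<in>F. (measure lebesgue Q / 2 ^ n) powr \<rho>)"
    using int_interval_in_ratio[OF F(2) assms(2)] assms(1) by (intro sum_mono powr_mono') auto
  finally show "nu n \<rho>' E \<le> \<dots>" .
qed fact

text \<open>A closed interval of integer length l \<ge> 1 contains l + 1 \<le> 2 l integers. The
  factor 2 replaces the additive 1, which would be awkward under powers.\<close>

lemma nat_points_interval:
  assumes "int_interval_in n Q"
  shows "finite {k. real k \<in> Q}" "real (card {k. real k \<in> Q}) \<le> 2 * measure lebesgue Q"
    and "real j \<in> Q \<Longrightarrow> real k \<in> Q \<Longrightarrow> 1 + \<bar>real j - real k\<bar> \<le> 2 * measure lebesgue Q"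
proof -
  obtain a b :: int where ab: "a < b" "Q \<subseteq> {real_of_int a..real_of_int b}" "measure lebesgue Q = real_of_int (b - a)"
    using int_interval_in_measure[OF assms(1)] by metis
  have sub: "int ` {k. real k \<in> Q} \<subseteq> {a..b}"
  proof safe
    fix k assume "real k \<in> Q"
    hence "real_of_int a \<le> real_of_int (int k)" "real_of_int (int k) \<le> real_of_int b" using ab(2) by auto
    thus "int k \<in> {a..b}" by (simp only: of_int_le_iff atLeastAtMost_iff)
  qed
  hence "finite (int ` {k. real k \<in> Q})" by (rule finite_subset) simp
  thus "finite {k. real k \<in> Q}" by (rule finite_imageD) (simp add: inj_on_def)
  have c: "card {k. real k \<in> Q} = card (int ` {k. real k \<in> Q})" by (simp add: card_image)
  have "card (int ` {k. real k \<in> Q}) \<le> card {a..b}" using sub by (intro card_mono) auto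
  hence "int (card {k. real k \<in> Q}) \<le> 2 * (b - a)" unfolding c using ab(1) by simp
  hence "real_of_int (int (card {k. real k \<in> Q})) \<le> real_of_int (2 * (b - a))" by (simp only: of_int_le_iff)
  thus "real (card {k. real k \<in> Q}) \<le> 2 * measure lebesgue Q" using ab(3) by simp
  have "1 \<le> real_of_int (b - a)" using ab(1) by linarith
  thus "1 + \<bar>real j - real k\<bar> \<le> 2 * measure lebesgue Q" if "real j \<in> Q" "real k \<in> Q"
  proof -
    have "real j \<in> {real_of_int a..real_of_int b}" "real k \<in> {real_of_int a..real_of_int b}"
      using that ab(2) by auto
    hence "\<bar>real j - real k\<bar> \<le> real_of_int (b - a)" by auto
    thus ?thesis using \<open>1 \<le> real_of_int (b - a)\<close> ab(3) by linarith
  qed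
qed

text \<open>For ratios in (0, 1] and \<rho> \<le> 1 the power dominates the ratio itself, and a
  covering interval accounts for at most twice its length in integer points.\<close>

lemma nu_ge_card:
  assumes P: "finite P" "real ` P \<subseteq> E \<inter> shell n" and n: "0 < n" and \<rho>: "\<rho> \<le> 1"
  shows "real (card P) / (2 * 2 ^ n) \<le> nu n \<rho> E"
proof (rule nu_ge[OF n])
  fix F assume F: "finite F" "\<And>Q. Q \<in> F \<Longrightarrow> int_interval_in n Q" "E \<inter> shell n \<subseteq> \<Union>F"
  have "P \<subseteq> (\<Union>Q\<in>F. {k. real k \<in> Q})" using P(2) F(3) by blast
  hence "card P \<le> card (\<Union>Q\<in>F. {k. real k \<in> Q})"
    using F(1,2) nat_points_interval(1) by (intro card_mono) auto
  also have "\<dots> \<le> (\<Sum>Q\<in>F. card {k. real k \<in> Q})" by (rule card_UN_le) (rule F)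
  finally have "real (card P) \<le> (\<Sum>Q\<in>F. real (card {k. real k \<in> Q}))"
    by (metis of_nat_le_iff of_nat_sum)
  also have "\<dots> \<le> (\<Sum>Q\<in>F. 2 * measure lebesgue Q)"
    using F(2) by (intro sum_mono nat_points_interval(2))
  finally have "real (card P) / (2 * 2 ^ n) \<le> (\<Sum>Q\<in>F. 2 * measure lebesgue Q) / (2 * 2 ^ n)"
    by (rule divide_right_mono) simp
  also have "\<dots> = (\<Sum>Q\<in>F. measure lebesgue Q / 2 ^ n)"
    by (simp add: sum_divide_distrib)
  also have "\<dots> \<le> (\<Sum>Q\<in>F. (measure lebesgue Q / 2 ^ n) powr \<rho>)"
  proof (rule sum_mono)
    fix Q assume "Q \<in> F"
    from int_interval_in_ratio[OF F(2)[OF this] n]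
    have "0 < measure lebesgue Q / 2 ^ n" "measure lebesgue Q / 2 ^ n \<le> 1" by auto
    thus "measure lebesgue Q / 2 ^ n \<le> (measure lebesgue Q / 2 ^ n) powr \<rho>"
      using powr_mono'[of \<rho> 1 "measure lebesgue Q / 2 ^ n"] \<rho> by simp
  qed
  finally show "real (card P) / (2 * 2 ^ n) \<le> (\<Sum>Q\<in>F. (measure lebesgue Q / 2 ^ n) powr \<rho>)" .
qed

text \<open>The energy method for a discrete set. Each point is charged to one covering interval,
  and Cauchy-Schwarz over the intervals bounds \<open>(card P) ^ 2\<close> by the sum of
  \<open>(card (R Q)) ^ 2 / l Q\<close> times the sum of \<open>l Q\<close>. Two points of one
  interval have kernel at least \<open>1 / l Q\<close>, so the first sum is at most the energy; the
  second is a multiple of the covering sum.\<close>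

lemma nu_ge_energy:
  fixes \<rho> :: real
  assumes P: "finite P" "real ` P \<subseteq> E \<inter> shell n" and n: "0 < n" and \<rho>: "0 \<le> \<rho>"
  defines "I \<equiv> (\<Sum>j\<in>P. \<Sum>k\<in>P. (1 + \<bar>real j - real k\<bar>) powr (-\<rho>))"
  shows "(real (card P))\<^sup>2 \<le> 2 powr (\<rho> * (n + 1)) * I * nu n \<rho> E"
proof (cases "P = {}")
  case False
  then obtain k0 where k0: "k0 \<in> P" by auto
  have "0 < (\<Sum>k\<in>P. (1 + \<bar>real j - real k\<bar>) powr (-\<rho>))" for j
    using P k0 by (intro sum_pos) (auto simp: add_pos_nonneg)
  hence I: "0 < I" unfolding I_def using P k0 by (intro sum_pos) auto
  have "(real (card P))\<^sup>2 / (2 powr (\<rho> * (n + 1)) * I) \<le> nu n \<rho> E"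
  proof (rule nu_ge[OF n])
    fix F assume F: "finite F" "\<And>Q. Q \<in> F \<Longrightarrow> int_interval_in n Q" "E \<inter> shell n \<subseteq> \<Union>F"
    \<comment> \<open>Covering intervals may overlap; choosing one for each point makes the classes
      \<open>R Q\<close> a partition of P.\<close>
    have "\<forall>k\<in>P. \<exists>Q. Q \<in> F \<and> real k \<in> Q" using P(2) F(3) by blast
    then obtain q where q: "\<And>k. k \<in> P \<Longrightarrow> q k \<in> F" "\<And>k. k \<in> P \<Longrightarrow> real k \<in> q k" by metis
    define R where "R Q = {k\<in>P. q k = Q}" for Q
    define l where "l Q = (2 * measure lebesgue Q) powr \<rho>" for Q :: "real set"
    have l: "0 < l Q" if "Q \<in> F" for Q
      using int_interval_in_ratio(1)[OF F(2)[OF that] n] by (simp add: l_def)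
    have "real (card P) = (\<Sum>Q\<in>F. real (card (R Q)))"
      using sum.group[OF P(1) F(1), of q "\<lambda>_. 1::real"] q(1) by (simp add: R_def image_subset_iff)
    also have "\<dots> = (\<Sum>Q\<in>F. (real (card (R Q)) / sqrt (l Q)) * sqrt (l Q))"
      by (intro sum.cong refl) (use l in \<open>force simp: less_le\<close>)
    also have "\<dots>\<^sup>2 \<le> (\<Sum>Q\<in>F. (real (card (R Q)) / sqrt (l Q))\<^sup>2) * (\<Sum>Q\<in>F. (sqrt (l Q))\<^sup>2)"
      by (rule Cauchy_Schwarz_ineq_sum)
    also have "(\<Sum>Q\<in>F. (sqrt (l Q))\<^sup>2) = (\<Sum>Q\<in>F. l Q)"
      using l by (intro sum.cong refl) (simp add: less_imp_le)
    finally have cs: "(real (card P))\<^sup>2 \<le> (\<Sum>Q\<in>F. (real (card (R Q)) / sqrt (l Q))\<^sup>2) * (\<Sum>Q\<in>F. l Q)" .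
    have "(\<Sum>Q\<in>F. (real (card (R Q)) / sqrt (l Q))\<^sup>2) \<le>
        (\<Sum>Q\<in>F. \<Sum>j\<in>R Q. \<Sum>k\<in>P. (1 + \<bar>real j - real k\<bar>) powr (-\<rho>))"
    proof (rule sum_mono)
      fix Q assume Q: "Q \<in> F"
      have "(real (card (R Q)) / sqrt (l Q))\<^sup>2 = (\<Sum>j\<in>R Q. \<Sum>k\<in>R Q. 1 / l Q)"
        using l[OF Q] by (simp add: power_divide power2_eq_square)
      also have "\<dots> \<le> (\<Sum>j\<in>R Q. \<Sum>k\<in>R Q. (1 + \<bar>real j - real k\<bar>) powr (-\<rho>))"
      proof (intro sum_mono)
        fix j k assume jk: "j \<in> R Q" "k \<in> R Q"
        have "real j \<in> Q" "real k \<in> Q" using jk q(2) by (auto simp: R_def)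
        from nat_points_interval(3)[OF F(2)[OF Q] this]
        have "(2 * measure lebesgue Q) powr (-\<rho>) \<le> (1 + \<bar>real j - real k\<bar>) powr (-\<rho>)"
          using \<rho> by (intro powr_mono2') auto
        thus "1 / l Q \<le> (1 + \<bar>real j - real k\<bar>) powr (-\<rho>)"
          by (simp add: l_def powr_minus_divide)
      qed
      also have "\<dots> \<le> (\<Sum>j\<in>R Q. \<Sum>k\<in>P. (1 + \<bar>real j - real k\<bar>) powr (-\<rho>))"
        using P(1) by (intro sum_mono sum_mono2) (auto simp: R_def)
      finally show "(real (card (R Q)) / sqrt (l Q))\<^sup>2 \<le>
          (\<Sum>j\<in>R Q. \<Sum>k\<in>P. (1 + \<bar>real j - real k\<bar>) powr (-\<rho>))" .
    qed
    also have "\<dots> = I"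
      unfolding I_def R_def using q(1) by (intro sum.group P F) auto
    finally have "(\<Sum>Q\<in>F. (real (card (R Q)) / sqrt (l Q))\<^sup>2) * (\<Sum>Q\<in>F. l Q) \<le> I * (\<Sum>Q\<in>F. l Q)"
      using l by (intro mult_right_mono sum_nonneg) (simp_all add: less_imp_le)
    with cs have "(real (card P))\<^sup>2 \<le> I * (\<Sum>Q\<in>F. l Q)" by (rule order_trans)
    \<comment> \<open>\<open>l Q\<close> uses absolute lengths; the normalisation of the content
      costs the factor \<open>(2 * 2 ^ n) powr \<rho>\<close>.\<close>
    also have "(\<Sum>Q\<in>F. l Q) = 2 powr (\<rho> * (n + 1)) * (\<Sum>Q\<in>F. (measure lebesgue Q / 2 ^ n) powr \<rho>)"
      unfolding sum_distrib_left
    proof (intro sum.cong refl)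
      fix Q :: "real set"
      have "(2 ^ Suc n) powr \<rho> = (2 powr real (Suc n)) powr \<rho>"
        by (subst powr_realpow) simp_all
      also have "\<dots> = 2 powr (\<rho> * (n + 1))"
        by (simp add: powr_powr mult.commute add.commute)
      finally have "2 powr (\<rho> * (n + 1)) = (2 ^ Suc n) powr \<rho>" by simp
      hence "2 powr (\<rho> * (n + 1)) * (measure lebesgue Q / 2 ^ n) powr \<rho> = (2 ^ Suc n * (measure lebesgue Q / 2 ^ n)) powr \<rho>"
        using powr_mult[of "2 ^ Suc n" "measure lebesgue Q / 2 ^ n" \<rho>] by (simp only:)
      thus "l Q = 2 powr (\<rho> * (n + 1)) * (measure lebesgue Q / 2 ^ n) powr \<rho>"
        by (simp add: l_def)
    qed
    finally show "(real (card P))\<^sup>2 / (2 powr (\<rho> * (n + 1)) * I) \<le> (\<Sum>Q\<in>F. (measure lebesgue Q / 2 ^ n) powr \<rho>)"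
      using I by (simp add: pos_divide_le_eq mult_ac)
  qed
  thus ?thesis using I by (simp add: pos_divide_le_eq mult_ac)
qed (simp add: I_def)

text \<open>For m < n both ends of the shell are multiples of \<open>2 ^ m\<close>, so half-open
  grid intervals tile it, and those that meet E form an admissible cover.\<close>

lemma nu_le_grid:
  fixes E :: "real set"
  assumes m: "m < n"
  defines "J \<equiv> {j\<in>{2 ^ (n - 1 - m)..<2 ^ (n - m)}. \<exists>t\<in>{real j * 2 ^ m..<real j * 2 ^ m + 2 ^ m}. t \<in> E}"
  shows "nu n \<rho> E \<le> real (card J) * (2 ^ m / 2 ^ n) powr \<rho>"
proof -
  define Q where "Q j = {real j * 2 ^ m..<real j * 2 ^ m + 2 ^ m :: real}" for j :: nat
  have J: "finite J" by (simp add: J_def)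
  have mn: "(2::real) ^ (n - 1 - m) * 2 ^ m = 2 ^ (n - 1)" "(2::real) ^ (n - m) * 2 ^ m = 2 ^ n"
    using m by (simp_all flip: power_add)
  have Qin: "int_interval_in n (Q j)" if "j \<in> J" for j
  proof -
    have "real (2 ^ (n - 1 - m)) \<le> real j" using that unfolding J_def by (simp only: of_nat_le_iff) simp
    hence "2 ^ (n - 1 - m) * 2 ^ m \<le> real j * 2 ^ m" by (intro mult_right_mono) auto
    moreover have "Suc j \<le> 2 ^ (n - m)" using that by (simp add: J_def Suc_le_eq)
    hence "real (Suc j) \<le> real (2 ^ (n - m))" by (simp only: of_nat_le_iff)
    hence "(1 + real j) * 2 ^ m \<le> 2 ^ (n - m) * 2 ^ m" by (intro mult_right_mono) auto
    hence "real j * 2 ^ m + 2 ^ m \<le> 2 ^ n" using mn by (simp add: algebra_simps)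
    ultimately have "Q j \<subseteq> shell n" unfolding mn by (auto simp: Q_def shell_def)
    thus ?thesis unfolding int_interval_in_def
      by (intro conjI exI[of _ "int j * 2 ^ m"] exI[of _ "int j * 2 ^ m + 2 ^ m"]) (auto simp: Q_def)
  qed
  have "E \<inter> shell n \<subseteq> \<Union>(Q ` J)"
  proof
    fix t assume t: "t \<in> E \<inter> shell n"
    hence t': "2 ^ (n - 1) \<le> t" "t < 2 ^ n" by (auto simp: shell_def)
    define j where "j = nat \<lfloor>t / 2 ^ m\<rfloor>"
    have t0: "0 \<le> t" using t'(1) by (rule order_trans[rotated]) simp
    hence "real j \<le> t / 2 ^ m" "t / 2 ^ m < real j + 1"
      unfolding j_def by auto
    hence tQ: "t \<in> Q j" by (auto simp: Q_def field_simps)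
    have "2 ^ (n - 1 - m) * 2 ^ m < (real j + 1) * 2 ^ m"
      using t'(1) tQ unfolding mn by (auto simp: Q_def algebra_simps)
    hence "real (2 ^ (n - 1 - m)) < real (Suc j)" by simp
    hence 1: "2 ^ (n - 1 - m) \<le> j" by (simp only: of_nat_less_iff)
    have "real j * 2 ^ m < 2 ^ (n - m) * 2 ^ m" using t'(2) tQ unfolding mn by (auto simp: Q_def)
    hence "real j < real (2 ^ (n - m))" by simp
    hence "j < 2 ^ (n - m)" by (simp only: of_nat_less_iff)
    with 1 tQ t have "j \<in> J" by (auto simp: J_def Q_def)
    thus "t \<in> \<Union>(Q ` J)" using tQ by blast
  qed
  hence "nu n \<rho> E \<le> (\<Sum>S\<in>Q ` J. (measure lebesgue S / 2 ^ n) powr \<rho>)"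
    using J Qin by (intro nu_le) auto
  also have "\<dots> \<le> (\<Sum>j\<in>J. (measure lebesgue (Q j) / 2 ^ n) powr \<rho>)"
    using J by (intro sum_image_le[of J _ Q, unfolded o_def]) auto
  also have "\<dots> = real (card J) * (2 ^ m / 2 ^ n) powr \<rho>"
    by (simp add: Q_def)
  finally show ?thesis .
qed

section \<open>Divergence of the contents\<close>

text \<open>In HOL \<open>0 powr \<gamma>\<close> is 0 also for \<gamma> = 0. This concerns only the
  time 0, which lies in the region as soon as \<open>b 0 = 0\<close>.\<close>

definition region :: "(real \<Rightarrow> real) \<Rightarrow> real \<Rightarrow> real set" where
  "region b \<gamma> = {t. 0 \<le> t \<and> \<bar>b t\<bar> \<le> t powr \<gamma>}"

text \<open>The factor \<open>1/2\<close> leaves room for the path to move while staying in the region.\<close>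

definition hits :: "(real \<Rightarrow> real) \<Rightarrow> real \<Rightarrow> nat \<Rightarrow> nat set" where
  "hits b \<gamma> n = {k. k \<in> {2 ^ n..<2 ^ Suc n} \<and> \<bar>b (real k)\<bar> \<le> real k powr \<gamma> / 2}"

lemma finite_hits [simp]: "finite (hits b \<gamma> n)"
  by (simp add: hits_def)

lemma hits_bounds:
  assumes "k \<in> hits b \<gamma> n"
  shows "2 ^ n \<le> real k" "real k < 2 ^ Suc n" "1 \<le> real k" "\<bar>b (real k)\<bar> \<le> real k powr \<gamma> / 2"
proof -
  from assms have k: "2 ^ n \<le> k" "k < 2 ^ Suc n" by (auto simp: hits_def)
  hence "real (2 ^ n) \<le> real k" "real k < real (2 ^ Suc n)" by (simp_all only: of_nat_le_iff of_nat_less_iff)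
  thus "2 ^ n \<le> real k" "real k < 2 ^ Suc n" by simp_all
  have "1 \<le> (2::real) ^ n" by simp
  thus "1 \<le> real k" using \<open>2 ^ n \<le> real k\<close> by linarith
qed (use assms in \<open>simp add: hits_def\<close>)

lemma hits_subset_region: "real ` hits b \<gamma> n \<subseteq> region b \<gamma> \<inter> shell (Suc n)"
proof safe
  fix k assume k: "k \<in> hits b \<gamma> n"
  have "\<bar>b (real k)\<bar> \<le> real k powr \<gamma>" using hits_bounds(4)[OF k] by (rule order_trans) simp
  thus "real k \<in> region b \<gamma>" by (simp add: region_def)
  show "real k \<in> shell (Suc n)" using hits_bounds[OF k] by (simp add: shell_def)
qed

lemma sum_dyadic:
  fixes f :: "nat \<Rightarrow> real"
  shows "(\<Sum>k | k \<in> {1..<2 ^ N} \<and> P k. f k) = (\<Sum>n<N. \<Sum>k | k \<in> {2 ^ n..<2 ^ Suc n} \<and> P k. f k)"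
proof (induction N)
  case 0
  thus ?case by simp
next
  case (Suc N)
  let ?A = "{k. k \<in> {1..<2 ^ N} \<and> P k}" and ?B = "{k. k \<in> {2 ^ N..<2 ^ Suc N} \<and> P k}"
  have "{1..<2 ^ Suc N} = {1..<2 ^ N} \<union> {2 ^ N..<2 ^ Suc N :: nat}"
    by (rule ivl_disj_un_two(3)[symmetric]) auto
  hence "{k. k \<in> {1..<2 ^ Suc N} \<and> P k} = ?A \<union> ?B" by blast
  moreover have "sum f (?A \<union> ?B) = sum f ?A + sum f ?B" by (rule sum.union_disjoint) auto
  ultimately have "sum f {k. k \<in> {1..<2 ^ Suc N} \<and> P k} = sum f ?A + sum f ?B" by (simp only:)
  thus ?case unfolding sum.lessThan_Suc Suc.IH .
qed

text \<open>The fourth powers make the Chebyshev bounds summable.\<close>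

definition many_hits :: "(real \<Rightarrow> real) \<Rightarrow> real \<Rightarrow> bool" where
  "many_hits b \<gamma> \<longleftrightarrow> (\<forall>\<^sub>F i in sequentially.
     real (i ^ 4) / 24 \<le> (\<Sum>n<i ^ 4. \<Sum>k\<in>hits b \<gamma> n. real k powr (-(1/2) - \<gamma>)))"

lemma two_power_powr: "(2 ^ n :: real) powr c = 2 powr (c * real n)"
proof -
  have "(2 ^ n) powr c = (2 powr real n) powr c" by (simp add: powr_realpow)
  thus ?thesis by (simp add: powr_powr mult.commute)
qed

text \<open>The weight is largest at the left end of the shell. This turns weighted sums into
  normalised counts.\<close>

lemma hits_weight_le:
  assumes "0 \<le> \<gamma>"
  shows "(\<Sum>k\<in>hits b \<gamma> n. real k powr (-(1/2) - \<gamma>)) \<le> 2 powr ((-(1/2) - \<gamma>) * n) * real (card (hits b \<gamma> n))"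
proof -
  have "real k powr (-(1/2) - \<gamma>) \<le> 2 powr ((-(1/2) - \<gamma>) * n)" if "k \<in> hits b \<gamma> n" for k
  proof -
    have "real k powr (-(1/2) - \<gamma>) \<le> (2 ^ n) powr (-(1/2) - \<gamma>)"
      using hits_bounds[OF that] assms by (intro powr_mono2') auto
    thus ?thesis by (simp only: two_power_powr)
  qed
  hence "(\<Sum>k\<in>hits b \<gamma> n. real k powr (-(1/2) - \<gamma>)) \<le> (\<Sum>k\<in>hits b \<gamma> n. 2 powr ((-(1/2) - \<gamma>) * n))"
    by (rule sum_mono)
  thus ?thesis unfolding sum_constant by (simp only: mult.commute)
qed

text \<open>A summable majorant would bound sums that grow like \<open>i ^ 4\<close>. In its uses s
  is a sequence of contents or, in a proof by contradiction, a geometric sequence.\<close>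

lemma many_hits_not_summable:
  assumes many: "many_hits b \<gamma>" and c: "0 \<le> c" and s: "\<And>n. 0 \<le> s n"
    and le: "\<forall>\<^sub>F n in sequentially. (\<Sum>k\<in>hits b \<gamma> n. real k powr (-(1/2) - \<gamma>)) \<le> c * s n"
  shows "\<not> summable s"
proof
  define x where "x n = (\<Sum>k\<in>hits b \<gamma> n. real k powr (-(1/2) - \<gamma>))" for n
  assume "summable s"
  hence "summable (\<lambda>n. c * s n)" by (rule summable_mult)
  moreover have x0: "0 \<le> x n" for n by (simp add: x_def sum_nonneg)
  hence "\<forall>\<^sub>F n in sequentially. norm (x n) \<le> c * s n" using le by (simp add: x_def)
  ultimately have x: "summable x" by (rule summable_comparison_test_ev[rotated])
  have "\<forall>\<^sub>F i in sequentially. real (i ^ 4) / 24 \<le> suminf x"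
    using many unfolding many_hits_def
  proof eventually_elim
    case (elim i)
    thus ?case using sum_le_suminf[OF x, of "{..<i ^ 4}"] x0 by (simp add: x_def)
  qed
  moreover have "filterlim (\<lambda>i. real i ^ 4) at_top sequentially"
    by (intro filterlim_pow_at_top filterlim_real_sequentially) simp
  hence "\<forall>\<^sub>F i in sequentially. 24 * suminf x < real i ^ 4"
    by (simp add: filterlim_at_top_dense)
  ultimately have "\<forall>\<^sub>F i::nat in sequentially. False"
    by eventually_elim simp
  thus False by simp
qed

text \<open>At exponent 1/2 the weight is 1 / k, of order \<open>2 powr (-n)\<close> on the shell.
  This is the normalisation of \<open>nu_ge_card\<close>, so counting alone bounds the content from
  below.\<close>

lemma nu_critical_not_summable:
  assumes "many_hits b (1/2)" "\<rho> \<le> 1"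
  shows "\<not> summable (\<lambda>n. nu (Suc n) \<rho> (region b (1/2)))"
proof (rule many_hits_not_summable)
  show "\<forall>\<^sub>F n in sequentially. (\<Sum>k\<in>hits b (1/2) n. real k powr (-(1/2) - 1/2)) \<le> 4 * nu (Suc n) \<rho> (region b (1/2))"
  proof (rule always_eventually, rule allI)
    fix n
    have "(\<Sum>k\<in>hits b (1/2) n. real k powr (-(1/2) - 1/2)) \<le> 2 powr ((-(1/2) - 1/2) * n) * real (card (hits b (1/2) n))"
      by (rule hits_weight_le) simp
    also have "\<dots> = 4 * (real (card (hits b (1/2) n)) / (2 * 2 ^ Suc n))"
      by (simp add: powr_minus_divide powr_realpow)
    also have "\<dots> \<le> 4 * nu (Suc n) \<rho> (region b (1/2))"
      using assms(2) by (intro mult_left_mono nu_ge_card hits_subset_region) auto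
    finally show "(\<Sum>k\<in>hits b (1/2) n. real k powr (-(1/2) - 1/2)) \<le> 4 * nu (Suc n) \<rho> (region b (1/2))" .
  qed
qed (use assms nu_nonneg in auto)

text \<open>The discrete Riesz energy of order \<rho> of the counting measure on P. The 1 added to
  the distance gives diagonal terms the value 1.\<close>

definition energy :: "real \<Rightarrow> nat set \<Rightarrow> real" where
  "energy \<rho> P = (\<Sum>j\<in>P. \<Sum>k\<in>P. (1 + \<bar>real j - real k\<bar>) powr (-\<rho>))"

lemma energy_nonneg: "0 \<le> energy \<rho> P"
  by (simp add: energy_def sum_nonneg)

text \<open>With y the normalised energy and z the content of a shell, \<open>nu_ge_energy\<close>
  bounds the weighted count by 2 sqrt (y z). A second Cauchy-Schwarz, across the shells, gives
  \<open>(i ^ 4 / 24) ^ 2 \<le> 4 * i ^ 6 * suminf z\<close>, which fails for large i. Hits at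
  exponent 0 suffice here, as they lie in the regions of all exponents
  \<open>\<gamma> \<ge> 0\<close>.\<close>

lemma nu_zero_not_summable:
  fixes \<rho> :: real
  assumes many: "many_hits b 0" and \<rho>: "0 \<le> \<rho>" "\<rho> \<le> 1/2"
    and en: "\<forall>\<^sub>F i::nat in sequentially. (\<Sum>n<i ^ 4. 2 powr (-(1 - \<rho>) * n) * energy \<rho> (hits b 0 n)) \<le> real i ^ 6"
    and E: "\<And>n. real ` hits b 0 n \<subseteq> E"
  shows "\<not> summable (\<lambda>n. nu (Suc n) \<rho> E)"
proof
  assume sm: "summable (\<lambda>n. nu (Suc n) \<rho> E)"
  define y where "y n = 2 powr (-(1 - \<rho>) * n) * energy \<rho> (hits b 0 n)" for n
  define z where "z n = nu (Suc n) \<rho> E" for n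
  have y: "0 \<le> y n" for n by (simp add: y_def energy_nonneg)
  have z: "0 \<le> z n" for n by (simp add: z_def nu_nonneg)
  have x: "(\<Sum>k\<in>hits b 0 n. real k powr (-(1/2) - 0)) \<le> 2 * (sqrt (y n) * sqrt (z n))" for n
  proof -
    have "(real (card (hits b 0 n)))\<^sup>2 \<le> 2 powr (\<rho> * (Suc n + 1)) * energy \<rho> (hits b 0 n) * z n"
      unfolding z_def energy_def using E hits_subset_region[of b 0 n] \<rho>
      by (intro nu_ge_energy) auto
    hence "2 powr (- real n) * (real (card (hits b 0 n)))\<^sup>2 \<le>
        2 powr (- real n) * (2 powr (\<rho> * (Suc n + 1)) * energy \<rho> (hits b 0 n) * z n)"
      by (intro mult_left_mono) auto
    also have "\<dots> = 2 powr (2 * \<rho>) * (y n * z n)"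
    proof -
      have "2 powr (- real n) * 2 powr (\<rho> * (Suc n + 1)) = 2 powr (2 * \<rho>) * 2 powr (-(1 - \<rho>) * n)"
        unfolding powr_add[symmetric] by (simp add: algebra_simps)
      thus ?thesis by (simp add: y_def mult_ac)
    qed
    also have "\<dots> \<le> 4 * (y n * z n)"
    proof -
      have "2 powr (2 * \<rho>) \<le> (2::real) powr 2" using \<rho> by (intro powr_mono) auto
      thus ?thesis using y z by (intro mult_right_mono) auto
    qed
    finally have 1: "2 powr (- real n) * (real (card (hits b 0 n)))\<^sup>2 \<le> 4 * (y n * z n)" .
    have "2 powr ((-(1/2) - 0) * n) * real (card (hits b 0 n)) = sqrt (2 powr (- real n) * (real (card (hits b 0 n)))\<^sup>2)"
      by (simp add: real_sqrt_mult powr_powr flip: powr_half_sqrt)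
    also have "\<dots> \<le> sqrt (4 * (y n * z n))" using 1 by simp
    also have "\<dots> = 2 * (sqrt (y n) * sqrt (z n))" by (simp add: real_sqrt_mult)
    finally show ?thesis using hits_weight_le[of 0 b n] by simp
  qed
  have "\<forall>\<^sub>F i in sequentially. (real (i ^ 4) / 24)\<^sup>2 \<le> 4 * (real i ^ 6 * suminf z)"
    using many[unfolded many_hits_def] en
  proof eventually_elim
    case (elim i)
    have "real (i ^ 4) / 24 \<le> (\<Sum>n<i ^ 4. 2 * (sqrt (y n) * sqrt (z n)))"
      using elim(1) x by (rule order_trans[OF _ sum_mono])
    hence "(real (i ^ 4) / 24)\<^sup>2 \<le> (\<Sum>n<i ^ 4. 2 * (sqrt (y n) * sqrt (z n)))\<^sup>2"
      by (intro power_mono) auto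
    also have "\<dots> = 4 * (\<Sum>n<i ^ 4. sqrt (y n) * sqrt (z n))\<^sup>2"
      by (simp add: power_mult_distrib flip: sum_distrib_left)
    also have "\<dots> \<le> 4 * ((\<Sum>n<i ^ 4. (sqrt (y n))\<^sup>2) * (\<Sum>n<i ^ 4. (sqrt (z n))\<^sup>2))"
      by (intro mult_left_mono Cauchy_Schwarz_ineq_sum) auto
    also have "\<dots> = 4 * ((\<Sum>n<i ^ 4. y n) * (\<Sum>n<i ^ 4. z n))" using y z by simp
    also have "\<dots> \<le> 4 * (real i ^ 6 * suminf z)"
      using elim(2) sm y z unfolding y_def[symmetric]
      by (intro mult_left_mono mult_mono sum_le_suminf sum_nonneg) (auto simp: z_def)
    finally show ?case .
  qed
  moreover have "filterlim (\<lambda>i::nat. real i ^ 2) at_top sequentially"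
    by (intro filterlim_pow_at_top filterlim_real_sequentially) simp
  \<comment> \<open>2304 is 4 times the square of 24.\<close>
  hence "\<forall>\<^sub>F i::nat in sequentially. 2304 * suminf z < real i ^ 2"
    by (simp add: filterlim_at_top_dense)
  moreover have "\<forall>\<^sub>F i::nat in sequentially. 0 < i" by (rule eventually_gt_at_top)
  ultimately have "\<forall>\<^sub>F i::nat in sequentially. False"
  proof eventually_elim
    case (elim i)
    have "real i ^ 6 * (2304 * suminf z) < real i ^ 6 * real i ^ 2"
      using elim by (intro mult_strict_left_mono) auto
    moreover have "(real (i ^ 4) / 24)\<^sup>2 = real i ^ 6 * real i ^ 2 / 576"
      by (simp add: power_divide flip: power_mult power_add)
    ultimately show False using elim(1) by simp
  qed
  thus False by simp
qed

section \<open>Monotonicity, measurability and size of the regions\<close>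

lemma region_mono_exponent:
  "t \<in> region b \<gamma> \<Longrightarrow> 1 \<le> t \<Longrightarrow> \<gamma> \<le> q \<Longrightarrow> t \<in> region b q"
  using powr_mono[of \<gamma> q t] by (auto simp: region_def)

lemma region_measurable:
  assumes "continuous_on {0..} b"
  shows "region b \<gamma> \<in> sets borel"
proof -
  \<comment> \<open>Continuity of b is known on \<open>{0..}\<close> only; extension by 0 gives a
    Borel function on the line.\<close>
  define g where "g t = indicator {0..} t *\<^sub>R b t" for t
  have g: "g \<in> borel_measurable borel"
    unfolding g_def using assms by (intro borel_measurable_continuous_on_indicator) auto
  have "region b \<gamma> = {0..} \<inter> {t\<in>space borel. \<bar>g t\<bar> \<le> t powr \<gamma>}"
    by (auto simp: region_def g_def)
  moreover have "{t\<in>space borel. \<bar>g t\<bar> \<le> t powr \<gamma>} \<in> sets borel"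
    using g by (intro borel_measurable_le) auto
  ultimately show ?thesis by simp
qed

lemma region_cut_lmeasurable:
  assumes "continuous_on {0..} b"
  shows "region b \<gamma> \<inter> {0..c} \<in> lmeasurable"
proof (rule bounded_set_imp_lmeasurable)
  show "bounded (region b \<gamma> \<inter> {0..c})"
    by (rule bounded_subset[OF bounded_closed_interval]) blast
  have "region b \<gamma> \<inter> {0..c} \<in> sets borel"
    using region_measurable[OF assms] by (rule sets.Int) simp
  thus "region b \<gamma> \<inter> {0..c} \<in> sets lebesgue" by simp
qed

text \<open>Near a hit k the path is bounded by \<open>k powr \<gamma> / 2 + 1/2\<close>, which is
  at most \<open>k powr \<gamma>\<close> because this power is at least 1. So each hit brings an
  interval of length \<delta>, and \<delta> \<le> 1 keeps these disjoint.\<close>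

lemma measure_region_ge:
  assumes cont: "continuous_on {0..} b" and \<gamma>: "0 \<le> \<gamma>" "\<gamma> \<le> \<gamma>'" and \<delta>: "0 < \<delta>" "\<delta> \<le> 1"
    and osc: "\<And>j t. j < 2 ^ Suc n \<Longrightarrow> t \<in> {real j..real j + \<delta>} \<Longrightarrow> \<bar>b t - b (real j)\<bar> \<le> 1/2"
  shows "\<delta> * real (card (hits b \<gamma> n)) \<le> measure lebesgue (region b \<gamma>' \<inter> {0..2 ^ Suc n})"
proof -
  let ?U = "\<Union>k\<in>hits b \<gamma> n. {real k..<real k + \<delta>}"
  have "measure lebesgue ?U = (\<Sum>k\<in>hits b \<gamma> n. measure lebesgue {real k..<real k + \<delta>})"
  proof (rule measure_finite_Union)
    show "disjoint_family_on (\<lambda>k. {real k..<real k + \<delta>}) (hits b \<gamma> n)"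
    proof (unfold disjoint_family_on_def, intro ballI impI)
      fix j k assume "j \<in> hits b \<gamma> n" "k \<in> hits b \<gamma> n" "j \<noteq> k"
      hence "real j + 1 \<le> real k \<or> real k + 1 \<le> real j" by linarith
      thus "{real j..<real j + \<delta>} \<inter> {real k..<real k + \<delta>} = {}" using \<delta> by auto
    qed
  qed (use \<delta> in auto)
  also have "\<dots> = \<delta> * real (card (hits b \<gamma> n))" using \<delta> by simp
  finally have "\<delta> * real (card (hits b \<gamma> n)) = measure lebesgue ?U" by simp
  also have "\<dots> \<le> measure lebesgue (region b \<gamma>' \<inter> {0..2 ^ Suc n})"
  proof (rule measure_mono_fmeasurable)
    show "?U \<subseteq> region b \<gamma>' \<inter> {0..2 ^ Suc n}"
    proof safe
      fix k t assume k: "k \<in> hits b \<gamma> n" and t: "t \<in> {real k..<real k + \<delta>}"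
      note hb = hits_bounds[OF k]
      have kl: "k < 2 ^ Suc n" using k by (simp add: hits_def)
      have "\<bar>b t - b (real k)\<bar> \<le> 1/2" using osc[OF kl, of t] t by simp
      moreover have "1 \<le> real k powr \<gamma>" using hb \<gamma> by (intro ge_one_powr_ge_zero) auto
      moreover have "real k powr \<gamma> \<le> t powr \<gamma>" using t \<gamma> by (intro powr_mono2) auto
      moreover have "t powr \<gamma> \<le> t powr \<gamma>'" using t hb \<gamma> by (intro powr_mono) auto
      moreover have "\<bar>b t\<bar> \<le> \<bar>b t - b (real k)\<bar> + \<bar>b (real k)\<bar>" by linarith
      ultimately have "\<bar>b t\<bar> \<le> t powr \<gamma>'" using hb(4) by linarith
      thus "t \<in> region b \<gamma>'" using hb t by (auto simp: region_def)
      have "real (Suc k) \<le> real (2 ^ Suc n)" using kl by (simp only: of_nat_le_iff Suc_le_eq)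
      thus "t \<in> {0..2 ^ Suc n}" using t \<delta> hb by auto
    qed
  qed (use region_cut_lmeasurable[OF cont] in auto)
  finally show ?thesis .
qed

section \<open>Logarithmic density and upper mass dimension\<close>

text \<open>If the density were below d < 1/2 + \<gamma>, the region up to \<open>2 ^ n\<close>
  would eventually measure at most \<open>2 powr (d * n)\<close>. Each hit occupies length
  \<open>2 powr (-e * n)\<close>, so there are at most about \<open>2 powr ((d + e) * n)\<close>
  hits, whose weights decay like \<open>r ^ n\<close> with r < 1. The second exponent \<gamma>'
  leaves \<gamma> free to be a rational approximation from below.\<close>

lemma log_density_region_ge:
  assumes cont: "continuous_on {0..} b" and \<gamma>: "0 \<le> \<gamma>" "\<gamma> \<le> \<gamma>'" and many: "many_hits b \<gamma>"
    and osc: "\<And>m::nat. \<forall>\<^sub>F n in sequentially. \<forall>j<2 ^ n. \<forall>t\<in>{real j..real j + 2 powr (-(1 / Suc m) * n)}.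
       \<bar>b t - b (real j)\<bar> \<le> 1/2"
  shows "ereal (1/2 + \<gamma>) \<le> log_density (region b \<gamma>')"
proof (rule ccontr)
  assume "\<not> ereal (1/2 + \<gamma>) \<le> log_density (region b \<gamma>')"
  then obtain d where d: "log_density (region b \<gamma>') < ereal d" "d < 1/2 + \<gamma>"
    using ereal_dense2[of "log_density (region b \<gamma>')" "ereal (1/2 + \<gamma>)"] by (auto simp: not_le)
  obtain m :: nat where m: "1 / Suc m < 1/2 + \<gamma> - d"
    using d(2) reals_Archimedean[of "1/2 + \<gamma> - d"] by (auto simp: inverse_eq_divide)
  define e where "e = 1 / real (Suc m)"
  define r where "r = 2 powr (d + e - (1/2 + \<gamma>))"
  have "r < 2 powr 0" unfolding r_def using m by (intro powr_less_mono) (auto simp: e_def)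
  hence r: "0 < r" "r < 1" by (auto simp: r_def)
  have lt: "\<forall>\<^sub>F n in sequentially. ereal (log 2 (measure lebesgue (region b \<gamma>' \<inter> {0..2 ^ n})) / real n) < ereal d"
    using d(1) unfolding log_density_def by (rule Limsup_lessD)
  \<comment> \<open>The case \<open>x = 0\<close> is separate because \<open>log 2 0 = 0\<close>.\<close>
  have le: "x \<le> 2 powr (d * n)" if "ereal (log 2 x / real n) < ereal d" "0 < n" "0 \<le> x" for x and n :: nat
  proof (cases "x = 0")
    case False
    hence "0 < x" using that by simp
    moreover have "log 2 x < d * n" using that by (simp add: pos_divide_less_eq)
    ultimately show ?thesis using log_less_iff[of 2 x "d * n"] by simp
  qed simp
  have meas: "\<forall>\<^sub>F n in sequentially. measure lebesgue (region b \<gamma>' \<inter> {0..2 ^ n}) \<le> 2 powr (d * n)"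
    by (rule eventually_mono[OF eventually_conj[OF lt eventually_gt_at_top[of 0]]])
      (intro le measure_nonneg, simp_all only:)
  have "\<not> summable (\<lambda>n. r ^ n)"
  proof (rule many_hits_not_summable[OF many])
    have "\<forall>\<^sub>F n in sequentially. measure lebesgue (region b \<gamma>' \<inter> {0..2 ^ Suc n}) \<le> 2 powr (d * Suc n)"
      by (rule eventually_compose_filterlim[OF meas filterlim_Suc])
    moreover have "\<forall>\<^sub>F n in sequentially. \<forall>j<2 ^ Suc n. \<forall>t\<in>{real j..real j + 2 powr (-e * Suc n)}.
       \<bar>b t - b (real j)\<bar> \<le> 1/2"
      unfolding e_def by (rule eventually_compose_filterlim[OF osc[of m] filterlim_Suc])
    ultimately show "\<forall>\<^sub>F n in sequentially. (\<Sum>k\<in>hits b \<gamma> n. real k powr (-(1/2) - \<gamma>)) \<le> 2 powr (d + e) * r ^ n"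
    proof eventually_elim
      case (elim n)
      let ?c = "real (card (hits b \<gamma> n))"
      have "2 powr (-e * Suc n) \<le> 2 powr 0" by (intro powr_mono) (auto simp: e_def)
      hence "2 powr (-e * Suc n) * ?c \<le> measure lebesgue (region b \<gamma>' \<inter> {0..2 ^ Suc n})"
        using elim(2) by (intro measure_region_ge cont \<gamma>) auto
      hence "2 powr (-e * Suc n) * ?c \<le> 2 powr (d * Suc n)" using elim(1) by linarith
      hence "2 powr (e * Suc n) * (2 powr (-e * Suc n) * ?c) \<le> 2 powr (e * Suc n) * 2 powr (d * Suc n)"
        by (intro mult_left_mono) auto
      also have "2 powr (e * Suc n) * (2 powr (-e * Suc n) * ?c) = ?c"
        unfolding mult.assoc[symmetric] powr_add[symmetric] by simp
      finally have "?c \<le> 2 powr (e * Suc n) * 2 powr (d * Suc n)" .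
      hence "2 powr ((-(1/2) - \<gamma>) * n) * ?c \<le> 2 powr ((-(1/2) - \<gamma>) * n) * (2 powr (e * Suc n) * 2 powr (d * Suc n))"
        by (intro mult_left_mono) auto
      also have "\<dots> = 2 powr (d + e) * 2 powr ((d + e - (1/2 + \<gamma>)) * n)"
        unfolding powr_add[symmetric] by (simp add: algebra_simps)
      also have "2 powr ((d + e - (1/2 + \<gamma>)) * n) = r ^ n"
        by (simp add: r_def powr_powr flip: powr_realpow)
      finally show ?case using hits_weight_le[OF \<gamma>(1), of b n] by linarith
    qed
  qed (use r in auto)
  moreover have "summable (\<lambda>n. r ^ n)" using r by (intro summable_geometric) simp
  ultimately show False by simp
qed

text \<open>The index \<open>j = 0\<close> is left out because \<open>t powr q\<close> is monotone in \<open>q\<close> only for \<open>t \<ge> 1\<close>.\<close>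

definition few_hits :: "(real \<Rightarrow> real) \<Rightarrow> real \<Rightarrow> nat \<Rightarrow> real \<Rightarrow> nat \<Rightarrow> bool" where
  "few_hits b q m \<epsilon> n \<longleftrightarrow>
     real (card {j\<in>{1..<2 ^ (n - m)}. \<exists>t\<in>{real j * 2 ^ m..real j * 2 ^ m + 2 ^ m}. \<bar>b t\<bar> \<le> t powr q})
      \<le> 2 * (2 powr (q * n) + 4 * 2 powr (\<epsilon> * n) * sqrt (2 ^ m)) * sqrt (2 ^ (n - m) / 2 ^ m)
        * 2 powr (\<epsilon> * n)"

lemma card_pix_le:
  fixes E :: "real set"
  assumes E: "E \<subseteq> {0..2 ^ n}"
  shows "finite (pix E)"
    and "card (pix E) \<le> 4 * (2 + card {j\<in>{1..<2 ^ n}. \<exists>t\<in>{real j..real j + 1}. t \<in> E})"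
proof -
  define J where "J = {j\<in>{1..<2 ^ n}. \<exists>t\<in>{real j..real j + 1}. t \<in> E}"
  \<comment> \<open>J starts at 1, and a point equal to \<open>2 ^ n\<close> has its floor beyond
    the range of J.\<close>
  define J' where "J' = insert 0 (insert (2 ^ n) J)"
  have fin: "finite J'" by (simp add: J'_def J_def)
  have sub: "pix E \<subseteq> (\<Union>j\<in>J'. {int j - 1..int j + 2})"
  proof
    fix x assume "x \<in> pix E"
    \<comment> \<open>The infimum need not be attained, so a point at distance below 2 is taken
      instead of one at distance at most 1. Its floor j leaves the four candidates from j - 1 to j +
      2.\<close>
    hence ne: "E \<noteq> {}" and "infdist (real_of_int x) E < 2" by (auto simp: pix_def)
    then obtain t where t: "t \<in> E" "dist (real_of_int x) t < 2"
      using cInf_lessD[of "(\<lambda>a. dist (real_of_int x) a) ` E" 2] by (auto simp: infdist_def)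
    have t': "0 \<le> t" "t \<le> 2 ^ n" using t(1) E by auto
    define j where "j = nat \<lfloor>t\<rfloor>"
    have j: "real j \<le> t" "t < real j + 1" using t'(1) unfolding j_def by linarith+
    have "real j \<le> 2 ^ n" using j t' by linarith
    hence "j \<le> 2 ^ n" by simp
    hence "j \<in> J'" using j t(1) by (auto simp: J'_def J_def intro!: bexI[of _ t])
    moreover have "real_of_int (int j) - 2 < real_of_int x" "real_of_int x < real_of_int (int j) + 3"
      using t(2) j by (auto simp: dist_real_def)
    hence "int j - 1 \<le> x" "x \<le> int j + 2" by linarith+
    ultimately show "x \<in> (\<Union>j\<in>J'. {int j - 1..int j + 2})" by auto
  qed
  show "finite (pix E)" by (rule finite_subset[OF sub]) (use fin in auto)
  have "card (pix E) \<le> card (\<Union>j\<in>J'. {int j - 1..int j + 2})"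
    using sub fin by (intro card_mono) auto
  also have "\<dots> \<le> (\<Sum>j\<in>J'. card {int j - 1..int j + 2})" by (rule card_UN_le) fact
  also have "\<dots> = 4 * card J'" by simp
  also have "card J' \<le> 2 + card J"
    unfolding J'_def by (rule order_trans[OF card_insert_le_m1]) (auto intro: card_insert_le_m1 order_trans[OF card_insert_le_m1])
  finally show "card (pix E) \<le> 4 * (2 + card {j\<in>{1..<2 ^ n}. \<exists>t\<in>{real j..real j + 1}. t \<in> E})"
    by (simp add: J_def)
qed

text \<open>The floor of every point of E is a pixel, so the unit intervals to the right of the
  pixels cover E.\<close>

lemma measure_le_card_pix:
  assumes E: "E \<subseteq> {0..2 ^ n}" and meas: "E \<in> lmeasurable"
  shows "measure lebesgue E \<le> real (card (pix E))"
proof -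
  have fin: "finite (pix E)" by (rule card_pix_le) fact
  have "E \<subseteq> (\<Union>x\<in>pix E. {real_of_int x..<real_of_int x + 1})"
  proof
    fix t assume t: "t \<in> E"
    have "infdist (real_of_int \<lfloor>t\<rfloor>) E \<le> dist (real_of_int \<lfloor>t\<rfloor>) t" by (rule infdist_le) fact
    also have "\<dots> \<le> 1" by (simp add: dist_real_def) linarith
    finally have "\<lfloor>t\<rfloor> \<in> pix E" using t by (auto simp: pix_def)
    moreover have "t \<in> {real_of_int \<lfloor>t\<rfloor>..<real_of_int \<lfloor>t\<rfloor> + 1}" by simp
    ultimately show "t \<in> (\<Union>x\<in>pix E. {real_of_int x..<real_of_int x + 1})" by blast
  qed
  moreover have "{real_of_int x..<real_of_int x + 1} \<in> lmeasurable" for x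
    by (intro bounded_set_imp_lmeasurable) auto
  hence "(\<Union>x\<in>pix E. {real_of_int x..<real_of_int x + 1}) \<in> lmeasurable"
    using fin by (intro fmeasurable.finite_UN) auto
  ultimately have "measure lebesgue E \<le> measure lebesgue (\<Union>x\<in>pix E. {real_of_int x..<real_of_int x + 1})"
    using meas by (intro measure_mono_fmeasurable) auto
  also have "\<dots> \<le> (\<Sum>x\<in>pix E. measure lebesgue {real_of_int x..<real_of_int x + 1})"
    using fin by (intro measure_UNION_le) auto
  also have "\<dots> = real (card (pix E))" by simp
  finally show ?thesis .
qed

lemma log_density_le_upper_mass_dim:
  assumes "\<And>n::nat. E \<inter> {0..2 ^ n} \<in> lmeasurable"
  shows "log_density E \<le> upper_mass_dim E"
  unfolding log_density_def upper_mass_dim_def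
proof (rule Limsup_mono, rule always_eventually, rule allI)
  fix n :: nat
  let ?E = "E \<inter> {0..2 ^ n}"
  have le: "measure lebesgue ?E \<le> real (card (pix ?E))"
    using assms[of n] by (intro measure_le_card_pix[of ?E n]) auto
  have "log 2 (measure lebesgue ?E) \<le> log 2 (real (card (pix ?E)))"
  proof (cases "measure lebesgue ?E = 0")
    \<comment> \<open>Here \<open>log 2 0\<close> is 0 and not minus infinity; the comparison rests
      on the logarithm of a natural number being nonnegative in HOL.\<close>
    case True
    have "0 \<le> log 2 (real (card (pix ?E)))"
      by (cases "card (pix ?E) = 0") (auto simp: log_def)
    thus ?thesis by (simp add: True log_def)
  next
    case False
    hence pos: "0 < measure lebesgue ?E" using measure_nonneg[of lebesgue ?E] by linarith
    hence "0 < real (card (pix ?E))" using le by linarith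
    thus ?thesis using pos le log_le_cancel_iff[of 2 "measure lebesgue ?E" "real (card (pix ?E))"] by simp
  qed
  thus "ereal (log 2 (measure lebesgue ?E) / real n) \<le> ereal (log 2 (real (card (pix ?E))) / real n)"
    by (simp add: divide_right_mono)
qed

lemma sqrt_two_powr: "sqrt (2 powr x) = 2 powr (x / 2)"
  using powr_half_sqrt[of "2 powr x"] by (simp add: powr_powr)

text \<open>The exponent consists of q for the width of the region, 1/2 from the first moment, and
  \<epsilon> twice: once for the oscillation, when a sum is bounded by a product, and once for
  Markov's inequality.\<close>

lemma log_card_pix_region_le:
  fixes q \<epsilon> :: real
  assumes few: "few_hits b q 0 \<epsilon> n" and q: "0 \<le> q" "\<gamma> \<le> q" and eps: "0 < \<epsilon>" and n: "0 < n"
  defines "\<alpha> \<equiv> 1/2 + q + 2 * \<epsilon>"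
  shows "log 2 (real (card (pix (region b \<gamma> \<inter> {0..2 ^ n})))) / real n \<le> \<alpha> + 6 / real n"
proof -
  have \<alpha>: "0 \<le> \<alpha>" using q eps by (simp add: \<alpha>_def)
  let ?E = "region b \<gamma> \<inter> {0..2 ^ n}"
  let ?J = "{j\<in>{1..<2 ^ n}. \<exists>t\<in>{real j..real j + 1}. t \<in> ?E}"
  let ?H = "{j\<in>{1..<2 ^ n}. \<exists>t\<in>{real j..real j + 1}. \<bar>b t\<bar> \<le> t powr q}"
  have sub: "?J \<subseteq> ?H"
  proof safe
    fix j t assume j: "j \<in> {1..<2 ^ n}" and t: "t \<in> {real j..real j + 1}" "t \<in> region b \<gamma>"
    have "1 \<le> t" using j t(1) by auto
    with t(2) have "t \<in> region b q" by (rule region_mono_exponent) (rule q)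
    thus "\<exists>t\<in>{real j..real j + 1}. \<bar>b t\<bar> \<le> t powr q" using t(1) by (auto simp: region_def)
  qed
  have a: "1 \<le> 2 powr (c * real n)" if "0 \<le> c" for c
    using that by (intro ge_one_powr_ge_zero) auto
  have "real (card ?J) \<le> real (card ?H)"
    using sub by (simp only: of_nat_le_iff) (intro card_mono, auto)
  also have "\<dots> \<le> 2 * (2 powr (q * n) + 4 * 2 powr (\<epsilon> * n)) * sqrt (2 ^ n) * 2 powr (\<epsilon> * n)"
    using few by (simp add: few_hits_def)
  also have "sqrt (2 ^ n) = 2 powr (1/2 * n)"
    by (simp add: two_power_powr flip: powr_half_sqrt)
  also have "2 * (2 powr (q * n) + 4 * 2 powr (\<epsilon> * n)) * 2 powr (1/2 * n) * 2 powr (\<epsilon> * n) \<le>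
      2 * (5 * (2 powr (q * n) * 2 powr (\<epsilon> * n))) * 2 powr (1/2 * n) * 2 powr (\<epsilon> * n)"
  proof -
    have "2 powr (q * n) * 1 \<le> 2 powr (q * n) * 2 powr (\<epsilon> * n)"
      using a[of \<epsilon>] eps by (intro mult_left_mono) auto
    moreover have "1 * 2 powr (\<epsilon> * n) \<le> 2 powr (q * n) * 2 powr (\<epsilon> * n)"
      using a[of q] q by (intro mult_right_mono) auto
    ultimately have "2 powr (q * n) + 4 * 2 powr (\<epsilon> * n) \<le> 5 * (2 powr (q * n) * 2 powr (\<epsilon> * n))"
      by linarith
    thus ?thesis by (intro mult_right_mono mult_left_mono) simp_all
  qed
  also have "\<dots> = 10 * 2 powr (\<alpha> * n)"
  proof -
    have ex: "\<alpha> * n = q * n + \<epsilon> * n + 1/2 * n + \<epsilon> * n" by (simp add: \<alpha>_def algebra_simps)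
    have "2 * (5 * (u * v)) * w * v = 10 * (u * v * w * v)" for u v w :: real by simp
    thus ?thesis unfolding ex powr_add .
  qed
  finally have J: "real (card ?J) \<le> 10 * 2 powr (\<alpha> * n)" .
  have "card (pix ?E) \<le> 4 * (2 + card ?J)" by (rule card_pix_le) simp
  hence "real (card (pix ?E)) \<le> real (4 * (2 + card ?J))" by (simp only: of_nat_le_iff)
  also have "\<dots> = 8 + 4 * real (card ?J)" by simp
  \<comment> \<open>The constant 8 + 40 is rounded up to \<open>2 ^ 6\<close>, whence the 6 in the
    error term.\<close>
  also have "\<dots> \<le> 64 * 2 powr (\<alpha> * n)" using J a[OF \<alpha>] by linarith
  also have "\<dots> = 2 powr (6 + \<alpha> * n)" by (simp add: powr_add)
  finally have pix: "real (card (pix ?E)) \<le> 2 powr (6 + \<alpha> * n)" .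
  have "log 2 (real (card (pix ?E))) \<le> 6 + \<alpha> * n"
  proof (cases "card (pix ?E) = 0")
    case True
    thus ?thesis using \<alpha> by (simp add: log_def)
  next
    case False
    hence "0 < real (card (pix ?E))" by simp
    thus ?thesis using pix log_le_iff[of 2 "real (card (pix ?E))" "6 + \<alpha> * n"] by simp
  qed
  hence "log 2 (real (card (pix ?E))) / n \<le> (6 + \<alpha> * n) / n" by (rule divide_right_mono) simp
  also have "\<dots> = \<alpha> + 6 / n" using n by (simp add: field_simps)
  finally show "log 2 (real (card (pix ?E))) / real n \<le> \<alpha> + 6 / real n" .
qed

lemma upper_mass_dim_region_le:
  assumes few: "\<forall>\<^sub>F n in sequentially. few_hits b q 0 \<epsilon> n" and q: "0 \<le> q" "\<gamma> \<le> q" and eps: "0 < \<epsilon>"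
  shows "upper_mass_dim (region b \<gamma>) \<le> ereal (1/2 + q + 2 * \<epsilon>)"
proof -
  define \<alpha> where "\<alpha> = 1/2 + q + 2 * \<epsilon>"
  have "\<forall>\<^sub>F n in sequentially. log 2 (real (card (pix (region b \<gamma> \<inter> {0..2 ^ n})))) / real n \<le> \<alpha> + 6 / real n"
    using few eventually_gt_at_top[of "0::nat"]
    by eventually_elim (unfold \<alpha>_def, rule log_card_pix_region_le[OF _ q eps])
  hence "upper_mass_dim (region b \<gamma>) \<le> limsup (\<lambda>n. ereal (\<alpha> + 6 / real n))"
    unfolding upper_mass_dim_def by (intro Limsup_mono) simp
  also have "(\<lambda>n. \<alpha> + 6 / real n) \<longlonglongrightarrow> \<alpha> + 0"
    by (intro tendsto_add tendsto_const lim_const_over_n)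
  hence "limsup (\<lambda>n. ereal (\<alpha> + 6 / real n)) = ereal (\<alpha> + 0)"
    by (intro lim_imp_Limsup) auto
  finally show ?thesis by (simp add: \<alpha>_def)
qed

section \<open>Upper bounds on the contents of the regions\<close>

text \<open>At m near 2 q n about \<open>2 powr ((1/2 - q) * n)\<close> grid intervals are needed,
  up to two factors \<open>2 powr (\<epsilon> * n)\<close>, and each costs about
  \<open>2 powr (-\<rho> * (1 - 2 * q) * n)\<close>. The product has exponent -2 \<kappa> n. The
  choice \<epsilon> = \<kappa> / 2 spends one \<kappa> n on the two factors and keeps the
  other.\<close>

lemma nu_region_le:
  fixes q \<rho> :: real
  assumes q: "0 \<le> q" "q < 1/2" "\<gamma> \<le> q" and \<rho>: "1/2 < \<rho>" "\<rho> \<le> 1" and n: "0 < n"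
    and M: "real m \<le> 2 * q * n" "2 * q * n < real m + 1"
  defines "\<kappa> \<equiv> (\<rho> - 1/2) * (1 - 2 * q) / 2"
  assumes few: "few_hits b q m (\<kappa> / 2) n"
  shows "nu n \<rho> (region b \<gamma>) \<le> 20 * 2 powr (-\<kappa> * n)"
proof -
  define \<epsilon> where "\<epsilon> = \<kappa> / 2"
  have \<kappa>: "0 < \<kappa>" "0 < \<epsilon>" using q \<rho> by (simp_all add: \<kappa>_def \<epsilon>_def)
  note few = few[folded \<epsilon>_def]
  let ?H = "{j\<in>{1..<2 ^ (n - m)}. \<exists>t\<in>{real j * 2 ^ m..real j * 2 ^ m + 2 ^ m}. \<bar>b t\<bar> \<le> t powr q}"
  let ?J = "{j\<in>{2 ^ (n - 1 - m)..<2 ^ (n - m)}. \<exists>t\<in>{real j * 2 ^ m..<real j * 2 ^ m + 2 ^ m}. t \<in> region b \<gamma>}"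
  have "2 * q * n < 1 * real n" using q n by (intro mult_strict_right_mono) auto
  hence mn: "m < n" using M by simp
  have sub: "?J \<subseteq> ?H"
  proof safe
    fix j t assume j: "j \<in> {2 ^ (n - 1 - m)..<2 ^ (n - m)}"
      and t: "t \<in> {real j * 2 ^ m..<real j * 2 ^ m + 2 ^ m}" "t \<in> region b \<gamma>"
    have "0 < (2::nat) ^ (n - 1 - m)" by simp
    also have "\<dots> \<le> j" using j by simp
    finally have j1: "1 \<le> j" by simp
    thus "j \<in> {1..<2 ^ (n - m)}" using j by simp
    have "1 * 1 \<le> real j * 2 ^ m" using j1 by (intro mult_mono) auto
    hence "1 \<le> t" using t(1) by auto
    with t(2) have "t \<in> region b q" by (rule region_mono_exponent) (rule q)
    thus "\<exists>t\<in>{real j * 2 ^ m..real j * 2 ^ m + 2 ^ m}. \<bar>b t\<bar> \<le> t powr q"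
      using t(1) by (auto simp: region_def)
  qed
  \<comment> \<open>The summand 1 absorbs the rounding of 2 q n down to m, which enters with the
    factor 1 - \<rho>. It turns the constant 10 into 20.\<close>
  have ex: "\<epsilon> * n + q * n + (1/2 * n - m) + \<epsilon> * n + \<rho> * (real m - n) \<le> 1 + - \<kappa> * n"
  proof -
    have "(1 - \<rho>) * (2 * q * n) \<le> (1 - \<rho>) * (real m + 1)"
      using M \<rho> by (intro mult_left_mono) auto
    hence "2 * (q * n) - 2 * (\<rho> * (q * n)) \<le> real m + 1 - \<rho> * m - \<rho>" by (simp add: algebra_simps)
    moreover have "2 * (\<epsilon> * n) = \<kappa> * n" by (simp add: \<epsilon>_def)
    moreover have "2 * (\<kappa> * n) = \<rho> * n - 2 * (\<rho> * (q * n)) - n / 2 + q * n"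
      unfolding \<kappa>_def by (simp add: field_simps)
    moreover have "\<rho> * (real m - n) = \<rho> * m - \<rho> * n" by (simp add: algebra_simps)
    ultimately show ?thesis using \<rho> by linarith
  qed
  have "nu n \<rho> (region b \<gamma>) \<le> real (card ?J) * (2 ^ m / 2 ^ n) powr \<rho>"
    by (rule nu_le_grid) fact
  also have "\<dots> \<le> real (card ?H) * (2 ^ m / 2 ^ n) powr \<rho>"
    using sub by (intro mult_right_mono) (simp_all add: card_mono)
  also have "\<dots> \<le> 2 * (2 powr (q * n) + 4 * 2 powr (\<epsilon> * n) * sqrt (2 ^ m)) *
     sqrt (2 ^ (n - m) / 2 ^ m) * 2 powr (\<epsilon> * n) * (2 ^ m / 2 ^ n) powr \<rho>"
    using few by (intro mult_right_mono) (simp_all add: few_hits_def)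
  also have "sqrt (2 ^ (n - m) / 2 ^ m) = 2 powr (1/2 * n - m)"
  proof -
    have e: "2 ^ (n - m) = (2::real) powr (real n - real m)" "2 ^ m = (2::real) powr real m"
      using mn powr_realpow[of "2::real" "n - m"] by (simp_all add: of_nat_diff powr_realpow)
    have "(real n - real m - real m) / 2 = 1/2 * n - m" by (simp add: field_simps)
    thus ?thesis unfolding e powr_diff[symmetric] sqrt_two_powr by (simp only:)
  qed
  also have "(2 ^ m / 2 ^ n) powr \<rho> = 2 powr (\<rho> * (real m - n))"
  proof -
    have "(2::real) ^ m / 2 ^ n = 2 powr (real m - n)" by (simp add: powr_diff powr_realpow)
    thus ?thesis by (simp only: powr_powr mult.commute)
  qed
  also have "2 * (2 powr (q * n) + 4 * 2 powr (\<epsilon> * n) * sqrt (2 ^ m)) * 2 powr (1/2 * n - m) * 2 powr (\<epsilon> * n) *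
      2 powr (\<rho> * (real m - n)) \<le>
      2 * (5 * (2 powr (\<epsilon> * n) * 2 powr (q * n))) * 2 powr (1/2 * n - m) * 2 powr (\<epsilon> * n) * 2 powr (\<rho> * (real m - n))"
  proof -
    have "sqrt (2 ^ m) = 2 powr (1/2 * m)"
      by (simp add: two_power_powr flip: powr_half_sqrt)
    also have "\<dots> \<le> 2 powr (q * n)" using M by (intro powr_mono) auto
    finally have "2 powr (\<epsilon> * n) * sqrt (2 ^ m) \<le> 2 powr (\<epsilon> * n) * 2 powr (q * n)"
      by (intro mult_left_mono) auto
    moreover have "1 \<le> 2 powr (\<epsilon> * n)" using \<kappa> by (intro ge_one_powr_ge_zero) auto
    hence "1 * 2 powr (q * n) \<le> 2 powr (\<epsilon> * n) * 2 powr (q * n)" by (intro mult_right_mono) auto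
    ultimately have "2 powr (q * n) + 4 * 2 powr (\<epsilon> * n) * sqrt (2 ^ m) \<le> 5 * (2 powr (\<epsilon> * n) * 2 powr (q * n))"
      by linarith
    thus ?thesis by (intro mult_right_mono mult_left_mono) simp_all
  qed
  also have "\<dots> = 10 * 2 powr (\<epsilon> * n + q * n + (1/2 * n - m) + \<epsilon> * n + \<rho> * (real m - n))"
  proof -
    have "2 * (5 * (u * v)) * w * u * x = 10 * (u * v * w * u * x)" for u v w x :: real by simp
    thus ?thesis unfolding powr_add .
  qed
  also have "10 * 2 powr (\<epsilon> * n + q * n + (1/2 * n - m) + \<epsilon> * n + \<rho> * (real m - n)) \<le> 10 * 2 powr (1 + - \<kappa> * n)"
    by (rule mult_left_mono[OF powr_mono[OF ex]]) simp_all
  also have "\<dots> = 20 * 2 powr (-\<kappa> * n)" unfolding powr_add by simp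
  finally show "nu n \<rho> (region b \<gamma>) \<le> 20 * 2 powr (-\<kappa> * n)" .
qed

lemma nu_region_summable:
  fixes q \<rho> :: real
  assumes q: "0 \<le> q" "q < 1/2" "\<gamma> \<le> q" and \<rho>: "1/2 < \<rho>" "\<rho> \<le> 1"
    and few: "\<forall>\<^sub>F n in sequentially. few_hits b q (nat \<lfloor>2 * q * n\<rfloor>) ((\<rho> - 1/2) * (1 - 2 * q) / 2 / 2) n"
  shows "summable (\<lambda>n. nu (Suc n) \<rho> (region b \<gamma>))"
proof -
  define \<kappa> where "\<kappa> = (\<rho> - 1/2) * (1 - 2 * q) / 2"
  have \<kappa>: "0 < \<kappa>" using q \<rho> by (simp add: \<kappa>_def)
  have "\<forall>\<^sub>F n in sequentially. nu n \<rho> (region b \<gamma>) \<le> 20 * 2 powr (-\<kappa> * n)"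
    using few eventually_gt_at_top[of "0::nat"]
  proof eventually_elim
    case (elim n)
    have "0 \<le> 2 * q * n" using q by simp
    hence "real (nat \<lfloor>2 * q * n\<rfloor>) \<le> 2 * q * n" "2 * q * n < real (nat \<lfloor>2 * q * n\<rfloor>) + 1"
      by linarith+
    from nu_region_le[OF q \<rho> elim(2) this elim(1)] show ?case unfolding \<kappa>_def .
  qed
  hence "\<forall>\<^sub>F n in sequentially. nu (Suc n) \<rho> (region b \<gamma>) \<le> 20 * 2 powr (-\<kappa> * Suc n)"
    by (rule eventually_compose_filterlim[OF _ filterlim_Suc])
  hence "\<forall>\<^sub>F n in sequentially. norm (nu (Suc n) \<rho> (region b \<gamma>)) \<le> 20 * 2 powr (-\<kappa>) * (2 powr (-\<kappa>)) ^ n"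
  proof (rule eventually_mono)
    fix n assume le: "nu (Suc n) \<rho> (region b \<gamma>) \<le> 20 * 2 powr (-\<kappa> * Suc n)"
    have e: "2 powr (-\<kappa> * Suc n) = 2 powr (-\<kappa>) * (2 powr (-\<kappa>)) ^ n"
      by (subst power_Suc[symmetric], subst powr_power) (simp_all add: mult.commute)
    have "norm (nu (Suc n) \<rho> (region b \<gamma>)) = nu (Suc n) \<rho> (region b \<gamma>)"
      using nu_nonneg[of "Suc n" \<rho> "region b \<gamma>"] by simp
    with le show "norm (nu (Suc n) \<rho> (region b \<gamma>)) \<le> 20 * 2 powr (-\<kappa>) * (2 powr (-\<kappa>)) ^ n"
      unfolding e mult.assoc by (simp only:)
  qed
  moreover have "2 powr (-\<kappa>) < 2 powr 0" using \<kappa> by (intro powr_less_mono) auto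
  hence "summable (\<lambda>n. 20 * 2 powr (-\<kappa>) * (2 powr (-\<kappa>)) ^ n)"
    by (intro summable_mult summable_geometric) simp
  ultimately show ?thesis by (rule summable_comparison_test_ev)
qed

text \<open>The \<open>2 ^ n\<close> unit intervals of the shell cost of order
  \<open>2 powr (-\<rho> * n)\<close> each, so no set has dimension above 1.\<close>

lemma nu_summable_above_one:
  assumes "1 < \<rho>"
  shows "summable (\<lambda>n. nu (Suc n) \<rho> E)"
proof (rule summable_comparison_test')
  show "summable (\<lambda>n. (2 powr (1 - \<rho>)) ^ n)"
  proof (rule summable_geometric)
    have "2 powr (1 - \<rho>) < 2 powr 0" using assms by (intro powr_less_mono) auto
    thus "norm (2 powr (1 - \<rho>)) < 1" by simp
  qed
  fix n :: nat
  let ?J = "{j\<in>{2 ^ (Suc n - 1 - 0)..<2 ^ (Suc n - 0)}. \<exists>t\<in>{real j * 2 ^ 0..<real j * 2 ^ 0 + 2 ^ 0}. t \<in> E}"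
  have "nu (Suc n) \<rho> E \<le> real (card ?J) * (2 ^ 0 / 2 ^ Suc n) powr \<rho>"
    by (rule nu_le_grid) simp
  also have "card ?J \<le> card {2 ^ n..<2 ^ Suc n :: nat}" by (rule card_mono) auto
  hence "real (card ?J) \<le> real (2 ^ n)" by (simp only: of_nat_le_iff) simp
  hence "real (card ?J) * (2 ^ 0 / 2 ^ Suc n) powr \<rho> \<le> 2 ^ n * (2 ^ 0 / 2 ^ Suc n) powr \<rho>"
    by (intro mult_right_mono) auto
  also have "\<dots> \<le> 2 ^ n * (1 / 2 ^ n) powr \<rho>"
    using assms by (intro mult_left_mono powr_mono2) (auto simp: field_simps)
  also have "\<dots> = (2 powr (1 - \<rho>)) ^ n"
  proof -
    have e: "(2::real) ^ n = 2 powr real n" "1 / 2 ^ n = (2::real) powr (- real n)"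
      by (simp_all add: powr_realpow powr_minus_divide)
    have x: "real n + - real n * \<rho> = (1 - \<rho>) * real n" by (simp add: algebra_simps)
    have "2 ^ n * (1 / 2 ^ n) powr \<rho> = 2 powr real n * (2 powr (- real n)) powr \<rho>"
      by (subst e(2), subst e(1)) (rule refl)
    also have "\<dots> = 2 powr ((1 - \<rho>) * real n)" unfolding powr_powr powr_add[symmetric] x ..
    also have "\<dots> = (2 powr (1 - \<rho>)) ^ n" by (subst powr_power) (simp_all add: mult.commute)
    finally show ?thesis .
  qed
  finally show "norm (nu (Suc n) \<rho> E) \<le> (2 powr (1 - \<rho>)) ^ n"
    using nu_nonneg[of "Suc n" \<rho> E] by simp
qed

lemma nu_summable_mono:
  assumes "summable (\<lambda>n. nu (Suc n) \<rho> E)" "\<rho> \<le> \<rho>'"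
  shows "summable (\<lambda>n. nu (Suc n) \<rho>' E)"
  by (rule summable_comparison_test'[OF assms(1)]) (simp add: nu_nonneg nu_antimono_exponent[OF assms(2)])

lemma macro_Hdim_eqI:
  assumes "0 \<le> d" "\<And>\<rho>. d < \<rho> \<Longrightarrow> summable (\<lambda>n. nu (Suc n) \<rho> E)"
    and "\<And>\<rho>. 0 \<le> \<rho> \<Longrightarrow> \<rho> < d \<Longrightarrow> \<not> summable (\<lambda>n. nu (Suc n) \<rho> E)"
  shows "macro_Hdim E = d"
proof (rule antisym)
  show "macro_Hdim E \<le> d"
  proof (rule dense_ge)
    fix \<rho> assume "d < \<rho>"
    thus "macro_Hdim E \<le> \<rho>"
      unfolding macro_Hdim_def using assms by (intro cInf_lower bdd_belowI[of _ 0]) auto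
  qed
  show "d \<le> macro_Hdim E"
    unfolding macro_Hdim_def
  proof (rule cInf_greatest)
    show "{\<rho>. \<rho> \<ge> 0 \<and> summable (\<lambda>n. nu (Suc n) \<rho> E)} \<noteq> {}"
      using assms(1) assms(2)[of "d + 1"] by (auto intro!: exI[of _ "d + 1"])
    fix \<rho> assume "\<rho> \<in> {\<rho>. \<rho> \<ge> 0 \<and> summable (\<lambda>n. nu (Suc n) \<rho> E)}"
    thus "d \<le> \<rho>" using assms(3)[of \<rho>] by (cases "\<rho> < d") auto
  qed
qed

section \<open>Dimensions of the regions along a path\<close>

lemma log_density_region_lower:
  assumes cont: "continuous_on {0..} b" and \<gamma>: "0 \<le> \<gamma>" "\<gamma> \<le> 1/2"
    and many: "\<And>q::real. q \<in> \<rat> \<inter> {0..1/2::real} \<Longrightarrow> many_hits b q"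
    and osc: "\<And>m::nat. \<forall>\<^sub>F n in sequentially. \<forall>j<2 ^ n. \<forall>t\<in>{real j..real j + 2 powr (-(1 / Suc m) * n)}.
       \<bar>b t - b (real j)\<bar> \<le> 1/2"
  shows "ereal (1/2 + \<gamma>) \<le> log_density (region b \<gamma>)"
proof (rule ereal_le_epsilon2)
  fix e :: real assume e: "0 < e"
  have "\<exists>q. q \<in> \<rat> \<inter> {0..1/2::real} \<and> q \<le> \<gamma> \<and> \<gamma> \<le> q + e"
  \<comment> \<open>At 0 there is no nonnegative rational strictly below \<gamma>, but \<gamma> is
    itself rational.\<close>
  proof (cases "\<gamma> = 0")
    case True
    thus ?thesis using e by (intro exI[of _ 0]) auto
  next
    case False
    then obtain q where "q \<in> \<rat>" "max 0 (\<gamma> - e) < q" "q < \<gamma>"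
      using Rats_dense_in_real[of "max 0 (\<gamma> - e)" \<gamma>] \<gamma> e by auto
    thus ?thesis using \<gamma> by (intro exI[of _ q]) auto
  qed
  then obtain q where q: "q \<in> \<rat> \<inter> {0..1/2::real}" "q \<le> \<gamma>" "\<gamma> \<le> q + e" by blast
  have "ereal (1/2 + q) \<le> log_density (region b \<gamma>)"
    using q(1) by (intro log_density_region_ge[OF cont _ q(2) many[OF q(1)] osc]) simp
  hence "ereal (1/2 + q) + ereal e \<le> log_density (region b \<gamma>) + ereal e" by (rule add_right_mono)
  moreover have "ereal (1/2 + \<gamma>) \<le> ereal (1/2 + q) + ereal e" using q(3) by simp
  ultimately show "ereal (1/2 + \<gamma>) \<le> log_density (region b \<gamma>) + ereal e" by (rule order_trans[rotated])
qed

text \<open>A rational q slightly above \<gamma> only enlarges the region on times at least 1. One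
  half of e pays for q - \<gamma>, the other for twice 1 / Suc k.\<close>

lemma upper_mass_dim_region_upper:
  assumes \<gamma>: "0 \<le> \<gamma>"
    and few: "\<And>(q::real) (k::nat). q \<in> \<rat> \<Longrightarrow> 0 \<le> q \<Longrightarrow> \<forall>\<^sub>F n in sequentially. few_hits b q 0 (1 / Suc k) n"
  shows "upper_mass_dim (region b \<gamma>) \<le> ereal (1/2 + \<gamma>)"
proof (rule ereal_le_epsilon2)
  fix e :: real assume e: "0 < e"
  obtain q where q: "q \<in> \<rat>" "\<gamma> < q" "q < \<gamma> + e / 2"
    using Rats_dense_in_real[of \<gamma> "\<gamma> + e / 2"] e by auto
  obtain k :: nat where k: "1 / real (Suc k) < e / 4"
    using reals_Archimedean[of "e / 4"] e by (auto simp: inverse_eq_divide)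
  have "upper_mass_dim (region b \<gamma>) \<le> ereal (1/2 + q + 2 * (1 / Suc k))"
    using q \<gamma> by (intro upper_mass_dim_region_le few) auto
  also have "\<dots> \<le> ereal (1/2 + \<gamma> + e)"
  proof -
    have "1/2 + q + 2 * (1 / Suc k) \<le> 1/2 + \<gamma> + e" using q(3) k by linarith
    thus ?thesis by (simp only: ereal_less_eq)
  qed
  finally show "upper_mass_dim (region b \<gamma>) \<le> ereal (1/2 + \<gamma>) + ereal e" by simp
qed

text \<open>The upper bound needs a rational q strictly between \<gamma> and 1/2, which is where
  \<gamma> < 1/2 enters. The lower bound comes from exponent 0 for all \<gamma> alike, so the
  dimension does not depend on \<gamma>.\<close>

lemma macro_Hdim_region_subcritical:
  assumes \<gamma>: "0 \<le> \<gamma>" "\<gamma> < 1/2"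
    and many: "many_hits b 0"
    and en: "\<And>\<rho>::real. \<rho> \<in> \<rat> \<inter> {0..<1/2::real} \<Longrightarrow>
      \<forall>\<^sub>F i::nat in sequentially. (\<Sum>n<i ^ 4. 2 powr (-(1 - \<rho>) * n) * energy \<rho> (hits b 0 n)) \<le> real i ^ 6"
    and few: "\<And>(q::real) (\<rho>::real). q \<in> \<rat> \<inter> {0..<1/2::real} \<Longrightarrow> \<rho> \<in> \<rat> \<inter> {1/2<..1::real} \<Longrightarrow>
      \<forall>\<^sub>F n in sequentially. few_hits b q (nat \<lfloor>2 * q * n\<rfloor>) ((\<rho> - 1/2) * (1 - 2 * q) / 2 / 2) n"
  shows "macro_Hdim (region b \<gamma>) = 1/2"
proof (rule macro_Hdim_eqI)
  fix \<rho> :: real assume "1/2 < \<rho>"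
  then obtain r where r: "r \<in> \<rat>" "1/2 < r" "r < min \<rho> 1"
    using Rats_dense_in_real[of "1/2" "min \<rho> 1"] by auto
  obtain q where q: "q \<in> \<rat>" "\<gamma> < q" "q < 1/2" using Rats_dense_in_real[OF \<gamma>(2)] by auto
  have "summable (\<lambda>n. nu (Suc n) r (region b \<gamma>))"
    by (rule nu_region_summable[OF _ _ _ _ _ few[of q r]]) (use q r \<gamma> in auto)
  thus "summable (\<lambda>n. nu (Suc n) \<rho> (region b \<gamma>))" by (rule nu_summable_mono) (use r in simp)
next
  fix \<rho> :: real assume \<rho>: "0 \<le> \<rho>" "\<rho> < 1/2"
  obtain r where r: "r \<in> \<rat>" "\<rho> < r" "r < 1/2" using Rats_dense_in_real[OF \<rho>(2)] by auto
  have "\<not> summable (\<lambda>n. nu (Suc n) r (region b \<gamma>))"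
  proof (rule nu_zero_not_summable[OF many])
    show "real ` hits b 0 n \<subseteq> region b \<gamma>" for n
    proof safe
      fix k assume k: "k \<in> hits b 0 n"
      have "real k \<in> region b 0" using k hits_subset_region[of b 0 n] by blast
      thus "real k \<in> region b \<gamma>" using hits_bounds(3)[OF k] \<gamma>(1) by (rule region_mono_exponent)
    qed
  qed (use r \<rho> en in auto)
  thus "\<not> summable (\<lambda>n. nu (Suc n) \<rho> (region b \<gamma>))"
    using nu_summable_mono[of \<rho> "region b \<gamma>" r] r by auto
qed simp

lemma macro_Hdim_region_critical:
  assumes "many_hits b (1/2)"
  shows "macro_Hdim (region b (1/2)) = 1"
  using nu_summable_above_one nu_critical_not_summable[OF assms]
  by (intro macro_Hdim_eqI) auto

context brownian begin

lemma AE_eventually_few_hits: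
  fixes q \<epsilon> :: real
  assumes "0 \<le> q" "0 < \<epsilon>" "\<And>n. m n \<le> n"
  shows "AE \<omega> in M. \<forall>\<^sub>F n in sequentially. few_hits (B \<omega>) q (m n) \<epsilon> n"
  unfolding few_hits_def by (rule AE_few_hits) (use assms in auto)

lemma AE_many_hits_region:
  assumes "0 \<le> \<gamma>" "\<gamma> \<le> 1/2"
  shows "AE \<omega> in M. many_hits (B \<omega>) \<gamma>"
  using AE_many_hits[OF assms] unfolding many_hits_def sum_dyadic hits_def .

lemma AE_energy_hits:
  fixes \<rho> :: real
  assumes "0 \<le> \<rho>" "\<rho> < 1/2"
  shows "AE \<omega> in M. \<forall>\<^sub>F i::nat in sequentially.
    (\<Sum>n<i ^ 4. 2 powr (-(1 - \<rho>) * n) * energy \<rho> (hits (B \<omega>) 0 n)) \<le> real i ^ 6"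
proof -
  have "hits (B \<omega>) 0 n = {k::nat. k \<in> {2 ^ n..<2 ^ Suc n} \<and> \<bar>B \<omega> (real k)\<bar> \<le> 1/2}" for \<omega> n
  proof -
    \<comment> \<open>In HOL \<open>0 powr 0\<close> is 0, so k must be seen to be positive.\<close>
    have "real k powr 0 = 1" if "k \<in> {2 ^ n..<2 ^ Suc n}" for k
    proof -
      have "0 < (2::nat) ^ n" by simp
      also have "\<dots> \<le> k" using that by simp
      finally show ?thesis by simp
    qed
    thus ?thesis unfolding hits_def by (intro Collect_cong conj_cong refl) (simp only:)
  qed
  thus ?thesis unfolding energy_def using AE_energy[OF assms] by (simp only:)
qed

text \<open>On intervals of length \<open>2 powr (-4 * \<epsilon> * n)\<close> the general bound is
  4 times \<open>2 powr (-\<epsilon> * n)\<close>, which drops below 1/2. So a length decaying at an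
  arbitrarily slow exponential rate keeps the path within 1/2, and the loss disappears in the
  logarithmic limit.\<close>

lemma AE_unit_oscillation:
  fixes m :: nat
  shows "AE \<omega> in M. \<forall>\<^sub>F n in sequentially. \<forall>j<2 ^ n. \<forall>t\<in>{real j..real j + 2 powr (-(1 / Suc m) * n)}.
     \<bar>B \<omega> t - B \<omega> (real j)\<bar> \<le> 1/2"
proof -
  define \<epsilon> where "\<epsilon> = 1 / (4 * real (Suc m))"
  have \<epsilon>: "0 < \<epsilon>" "1 / real (Suc m) = 4 * \<epsilon>" by (simp_all add: \<epsilon>_def field_simps)
  have small: "\<forall>\<^sub>F n::nat in sequentially. 4 * 2 powr (\<epsilon> * n) * sqrt (2 powr (-(4 * \<epsilon>) * n)) \<le> 1/2"
  proof -
    have "2 powr (-\<epsilon>) < 2 powr 0" using \<epsilon> by (intro powr_less_mono) auto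
    hence "(\<lambda>n. (2 powr (-\<epsilon>)) ^ n) \<longlonglongrightarrow> 0" by (intro LIMSEQ_realpow_zero) auto
    hence "\<forall>\<^sub>F n in sequentially. (2 powr (-\<epsilon>)) ^ n < 1/8" by (rule order_tendstoD) simp
    thus ?thesis
    proof (rule eventually_mono)
      fix n :: nat assume le: "(2 powr (-\<epsilon>)) ^ n < 1/8"
      have "4 * 2 powr (\<epsilon> * n) * sqrt (2 powr (-(4 * \<epsilon>) * n)) = 4 * (2 powr (\<epsilon> * n) * 2 powr (-(4 * \<epsilon>) * n / 2))"
        by (simp only: sqrt_two_powr mult.assoc)
      also have "\<dots> = 4 * 2 powr (n * - \<epsilon>)"
        unfolding powr_add[symmetric] by (simp add: algebra_simps)
      also have "2 powr (n * - \<epsilon>) = (2 powr (-\<epsilon>)) ^ n" by (rule powr_power[symmetric]) simp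
      finally show "4 * 2 powr (\<epsilon> * n) * sqrt (2 powr (-(4 * \<epsilon>) * n)) \<le> 1/2" using le by linarith
    qed
  qed
  have "AE \<omega> in M. \<forall>\<^sub>F n in sequentially. \<forall>j<2 ^ n. \<forall>t\<in>{real j..real j + 2 powr (-(4 * \<epsilon>) * n)}.
     \<bar>B \<omega> t - B \<omega> (real j)\<bar> \<le> 4 * 2 powr (\<epsilon> * n) * sqrt (2 powr (-(4 * \<epsilon>) * n))"
    by (rule AE_oscillation) (use \<epsilon> in auto)
  thus ?thesis unfolding \<epsilon>(2)
  proof eventually_elim
    case (elim \<omega>)
    from eventually_conj[OF elim small] show ?case
      by (rule eventually_mono) (meson order_trans)
  qed
qed

end

theorem theorem1:
  fixes M :: "'a measure" and B :: "'a \<Rightarrow> real \<Rightarrow> real"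
  assumes "brownian_motion M B"
  shows "AE \<omega> in M. \<forall>\<gamma>\<in>{0..1/2::real}.
           macro_Hdim {t. 0 \<le> t \<and> \<bar>B \<omega> t\<bar> \<le> t powr \<gamma>} = (if \<gamma> < 1/2 then 1/2 else 1) \<and>
           upper_mass_dim {t. 0 \<le> t \<and> \<bar>B \<omega> t\<bar> \<le> t powr \<gamma>} = ereal (1/2 + \<gamma>) \<and>
           log_density {t. 0 \<le> t \<and> \<bar>B \<omega> t\<bar> \<le> t powr \<gamma>} = ereal (1/2 + \<gamma>)"
proof -
  interpret prob_space M using assms by (simp add: brownian_motion_def)
  interpret brownian M B by unfold_locales fact
  have ctb: "countable (\<rat> \<inter> A)" for A :: "real set" by (intro countable_Int1 countable_rat)
  have many: "AE \<omega> in M. \<forall>q\<in>\<rat> \<inter> {0..1/2::real}. many_hits (B \<omega>) q"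
    unfolding AE_ball_countable[OF ctb] by (auto intro: AE_many_hits_region)
  have osc: "AE \<omega> in M. \<forall>m::nat. \<forall>\<^sub>F n in sequentially. \<forall>j<2 ^ n.
      \<forall>t\<in>{real j..real j + 2 powr (-(1 / Suc m) * n)}. \<bar>B \<omega> t - B \<omega> (real j)\<bar> \<le> 1/2"
    unfolding AE_all_countable by (intro allI AE_unit_oscillation)
  have en: "AE \<omega> in M. \<forall>\<rho>\<in>\<rat> \<inter> {0..<1/2::real}. \<forall>\<^sub>F i::nat in sequentially.
      (\<Sum>n<i ^ 4. 2 powr (-(1 - \<rho>) * n) * energy \<rho> (hits (B \<omega>) 0 n)) \<le> real i ^ 6"
    unfolding AE_ball_countable[OF ctb] by (intro ballI AE_energy_hits) auto
  have few0: "AE \<omega> in M. \<forall>q\<in>\<rat> \<inter> {0::real..}. \<forall>k::nat. \<forall>\<^sub>F n in sequentially. few_hits (B \<omega>) q 0 (1 / Suc k) n"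
    unfolding AE_ball_countable[OF ctb] AE_all_countable
    by (intro ballI allI AE_eventually_few_hits) auto
  have few: "AE \<omega> in M. \<forall>q\<in>\<rat> \<inter> {0..<1/2::real}. \<forall>\<rho>\<in>\<rat> \<inter> {1/2<..1::real}. \<forall>\<^sub>F n in sequentially.
      few_hits (B \<omega>) q (nat \<lfloor>2 * q * n\<rfloor>) ((\<rho> - 1/2) * (1 - 2 * q) / 2 / 2) n"
    unfolding AE_ball_countable[OF ctb]
  proof (intro ballI AE_eventually_few_hits)
    fix q \<rho> :: real and n :: nat assume q: "q \<in> \<rat> \<inter> {0..<1/2::real}" and \<rho>: "\<rho> \<in> \<rat> \<inter> {1/2<..1::real}"
    show "0 \<le> q" using q by simp
    show "0 < (\<rho> - 1/2) * (1 - 2 * q) / 2 / 2" using q \<rho> by simp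
    have "2 * q * n \<le> 1 * real n" using q by (intro mult_right_mono) auto
    thus "nat \<lfloor>2 * q * n\<rfloor> \<le> n" by linarith
  qed
  show ?thesis
    using AE_path many osc en few0 few
  proof eventually_elim
    case (elim \<omega>)
    have cont: "continuous_on {0..} (B \<omega>)" using elim(1) by simp
    show ?case
      unfolding region_def[symmetric]
    proof
      fix \<gamma> :: real assume \<gamma>: "\<gamma> \<in> {0..1/2}"
      \<comment> \<open>The next three facts close a chain: the lower bound for the density, its
        comparison with the mass dimension, and the upper bound for the latter give both
        equalities.\<close>
      have lower: "ereal (1/2 + \<gamma>) \<le> log_density (region (B \<omega>) \<gamma>)"
        using cont \<gamma> elim(2,3) by (intro log_density_region_lower) auto
      have mid: "log_density (region (B \<omega>) \<gamma>) \<le> upper_mass_dim (region (B \<omega>) \<gamma>)"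
        by (intro log_density_le_upper_mass_dim region_cut_lmeasurable cont)
      have upper: "upper_mass_dim (region (B \<omega>) \<gamma>) \<le> ereal (1/2 + \<gamma>)"
        using \<gamma> elim(5) by (intro upper_mass_dim_region_upper) auto
      have "macro_Hdim (region (B \<omega>) \<gamma>) = (if \<gamma> < 1/2 then 1/2 else 1)"
      proof (cases "\<gamma> < 1/2")
        case True
        have "macro_Hdim (region (B \<omega>) \<gamma>) = 1/2"
        proof (rule macro_Hdim_region_subcritical)
          show "many_hits (B \<omega>) 0" using elim(2) by simp
        qed (use True \<gamma> elim(4,6) in auto)
        thus ?thesis using True by simp
      next
        case False
        hence "\<gamma> = 1/2" using \<gamma> by simp
        moreover have "macro_Hdim (region (B \<omega>) (1/2)) = 1"
          by (rule macro_Hdim_region_critical) (use elim(2) in simp)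
        ultimately show ?thesis by (simp only:) simp
      qed
      with lower mid upper show "macro_Hdim (region (B \<omega>) \<gamma>) = (if \<gamma> < 1/2 then 1/2 else 1) \<and>
          upper_mass_dim (region (B \<omega>) \<gamma>) = ereal (1/2 + \<gamma>) \<and> log_density (region (B \<omega>) \<gamma>) = ereal (1/2 + \<gamma>)"
        by (intro conjI antisym) (auto intro: order_trans)
    qed
  qed
qed

end
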